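(* Let $V$ be a finite-dimensional real vector space. There is a one-to-one correspondence between the family of Hodge structures on $V$ and the family of pairs of endomorphisms $E, T \in \mathrm{End}_{\mathbb{R}}(V)$ satisfying $$[E,T]=0,\qquad \sin(\pi E)=0,\qquad \sinh(\pi T)=0,\qquad \sin\!\Big(\frac{\pi}{2}(E^2+T^2)\Big)=0 .$$
   Context: Let $\mathbb{S}=\mathrm{Res}_{\mathbb{C}/\mathbb{R}}\mathbb{G}_m$ be the Deligne torus, the real algebraic group whose real points are $\mathbb{C}^\times$. A Hodge structure of weight $n$ on a finite-dimensional real vector space $V$ is a homomorphism of real algebraic groups $h_n:\mathbb{S}\to \mathrm{GL}(V)$ such that, via $\mathbb{G}_{m}/\mathbb{R}\to\mathbb{S}\to\mathrm{GL}(V)$, an element $t\in\mathbb{G}_m/\mathbb{R}$ acts as $t^{-n}\cdot \mathrm{Id}$ (equivalently, a decomposition $V_{\mathbb{C}}=\bigoplus_{p+q=n}V^{p,q}$ with $\overline{V^{p,q}}=V^{q,p}$). In this statement a Hodge structure on $V$ means a finite direct sum $\rho=\bigoplus_{j=1}^k h_{n_j}$ of such representations of possibly different weights $n_j$, i.e. an algebraic representation $\rho:\mathbb{S}\to\mathrm{GL}(V)$ of this form. For an endomorphism $A$ of $V$ and an entire function $f(z)=\sum a_k z^k$, $f(A)$ denotes $\sum a_k A^k$; $[E,T]=ET-TE$. *)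

theory Defs
  imports "HOL-Analysis.Analysis"
begin

text \<open>
  The vector space \<open>V\<close> is the universe of a type of class \<^class>\<open>real_normed_vector\<close>, assumed to be
  finite-dimensional. The norm only serves to name the canonical topology of \<open>V\<close>: in finite
  dimension all norms are equivalent, so nothing below depends on it. (The class
  \<^class>\<open>euclidean_space\<close> would exclude \<open>V = 0\<close>.)
\<close>

definition finite_dimensional_space :: "'v::real_normed_vector itself \<Rightarrow> bool" where
  "finite_dimensional_space _ \<longleftrightarrow> (\<exists>B::'v set. finite B \<and> span B = UNIV)"


subsection \<open>Algebraic representations of the Deligne torus\<close>

text \<open>
  The Deligne torus has coordinate ring \<open>\<real>[x, y, 1/(x\<^sup>2 + y\<^sup>2)]\<close> and its real points, the nonzero
  complex numbers \<open>z = x + iy\<close>, are Zariski dense. A homomorphism of real algebraic groups to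
  \<open>GL(V)\<close> is therefore the same as a group homomorphism on real points whose matrix coefficients
  lie in that ring, i.e. are real polynomials in \<open>x, y\<close> divided by a power of
  \<open>x\<^sup>2 + y\<^sup>2 = (cmod z)\<^sup>2\<close>. (In \<^const>\<open>polynomial_function\<close> the domain \<^typ>\<open>complex\<close> is regarded as
  a real vector space, so these are not just the polynomials in \<open>z\<close>.)
  The value at \<open>0\<close>, which is not a point of the torus, is fixed by \<^const>\<open>extensional\<close>,
  so that equality of functions is equality of representations.
\<close>

definition algebraic_rep :: "(complex \<Rightarrow> 'v::real_normed_vector \<Rightarrow> 'v) \<Rightarrow> bool" where
  "algebraic_rep \<rho> \<longleftrightarrow>
     \<rho> \<in> extensional (- {0}) \<and>
     (\<forall>z. z \<noteq> 0 \<longrightarrow> linear (\<rho> z)) \<and>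
     \<rho> 1 = id \<and>
     (\<forall>z w. z \<noteq> 0 \<longrightarrow> w \<noteq> 0 \<longrightarrow> \<rho> (z * w) = \<rho> z \<circ> \<rho> w) \<and>
     (\<forall>v. \<exists>(N::nat) (p::complex \<Rightarrow> 'v). polynomial_function p \<and>
        (\<forall>z. z \<noteq> 0 \<longrightarrow> \<rho> z v = (1 / ((cmod z)\<^sup>2) ^ N) *\<^sub>R p z))"


subsection \<open>Hodge structures\<close>

text \<open>
  \<open>hodge_weight_on n W \<rho>\<close>: the representation \<open>\<rho>\<close> restricts to a Hodge structure of weight \<open>n\<close> on
  the subspace \<open>W\<close>. Algebraicity of the restriction is inherited from \<open>\<rho>\<close>.
\<close>

definition hodge_weight_on ::
    "int \<Rightarrow> 'v::real_normed_vector set \<Rightarrow> (complex \<Rightarrow> 'v \<Rightarrow> 'v) \<Rightarrow> bool" where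
  "hodge_weight_on n W \<rho> \<longleftrightarrow>
     subspace W \<and>
     (\<forall>z. z \<noteq> 0 \<longrightarrow> \<rho> z ` W \<subseteq> W) \<and>
     (\<forall>t::real. t \<noteq> 0 \<longrightarrow> (\<forall>w\<in>W. \<rho> (of_real t) w = (t powi (- n)) *\<^sub>R w))"

definition internal_direct_sum :: "nat \<Rightarrow> (nat \<Rightarrow> 'v::real_normed_vector set) \<Rightarrow> bool" where
  "internal_direct_sum k W \<longleftrightarrow>
     bij_betw (\<lambda>w. \<Sum>j<k. w j) (Pi\<^sub>E {..<k} W) UNIV"

definition hodge_structure :: "(complex \<Rightarrow> 'v::real_normed_vector \<Rightarrow> 'v) \<Rightarrow> bool" where
  "hodge_structure \<rho> \<longleftrightarrow>
     algebraic_rep \<rho> \<and>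
     (\<exists>(k::nat) (W :: nat \<Rightarrow> 'v set) (n :: nat \<Rightarrow> int).
        internal_direct_sum k W \<and> (\<forall>j<k. hodge_weight_on (n j) (W j) \<rho>))"


subsection \<open>Entire functions of endomorphisms\<close>

text \<open>
  \<open>f(A) = \<Sum> a\<^sub>k A\<^sup>k\<close>, where \<open>a\<^sub>k\<close> are the Taylor coefficients of \<open>f\<close> at \<open>0\<close>. It is used only for
  restrictions to \<open>\<real>\<close> of entire functions with real coefficients. The sum is taken pointwise, which
  on a finite-dimensional space is convergence in \<open>End(V)\<close>.
\<close>

definition entire_apply ::
    "(real \<Rightarrow> real) \<Rightarrow> ('v::real_normed_vector \<Rightarrow> 'v) \<Rightarrow> 'v \<Rightarrow> 'v" where
  "entire_apply f A v = (\<Sum>k. ((deriv ^^ k) f 0 / fact k) *\<^sub>R (A ^^ k) v)"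

definition commutator :: "('v::real_normed_vector \<Rightarrow> 'v) \<Rightarrow> ('v \<Rightarrow> 'v) \<Rightarrow> 'v \<Rightarrow> 'v" where
  "commutator E T v = E (T v) - T (E v)"

definition hodge_pair :: "('v::real_normed_vector \<Rightarrow> 'v) \<Rightarrow> ('v \<Rightarrow> 'v) \<Rightarrow> bool" where
  "hodge_pair E T \<longleftrightarrow>
     linear E \<and> linear T \<and>
     commutator E T = (\<lambda>v. 0) \<and>
     entire_apply (\<lambda>x. sin (pi * x)) E = (\<lambda>v. 0) \<and>
     entire_apply (\<lambda>x. sinh (pi * x)) T = (\<lambda>v. 0) \<and>
     entire_apply (\<lambda>x. sin (pi / 2 * x)) (\<lambda>v. (E ^^ 2) v + (T ^^ 2) v) = (\<lambda>v. 0)"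


subsection \<open>The correspondence\<close>

text \<open>
  The differential of \<open>\<rho>\<close> at the identity, evaluated on the basis \<open>1, i\<close> of the Lie algebra \<open>\<complex>\<close> of
  the torus: \<open>\<rho>(exp(s + i\<theta>)) = exp(sE + \<theta>T)\<close>. On \<open>V\<^sup>p\<^sup>q\<close>, where \<open>z\<close> acts as
  \<open>z\<^sup>-\<^sup>p (cnj z)\<^sup>-\<^sup>q\<close>, \<open>E\<close> is \<open>-(p + q)\<close> and \<open>T\<close> is \<open>-i(p - q)\<close>.
\<close>

definition hodge_generators ::
    "(complex \<Rightarrow> 'v::real_normed_vector \<Rightarrow> 'v) \<Rightarrow> ('v \<Rightarrow> 'v) \<times> ('v \<Rightarrow> 'v)" where
  "hodge_generators \<rho> =
     (\<lambda>v. vector_derivative (\<lambda>s::real. \<rho> (exp (of_real s)) v) (at 0),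
      \<lambda>v. vector_derivative (\<lambda>\<theta>::real. \<rho> (exp (\<i> * of_real \<theta>)) v) (at 0))"

end

(*
  On V^{pq} the torus acts through z^-p (cnj z)^-q = |z|^(n-m) z^m with n = -(p+q) and m = -(p-q), so the
  generators E and T are diagonalizable over the complex numbers with joint eigenvalues (n, i m), where n
  and m are integers of equal parity. The equations of a Hodge pair say exactly this: an entire function
  with simple zeros annihilates an endomorphism iff the latter is diagonalizable with eigenvalues among
  the zeros, which gives integral n from sin(pi E) = 0 and integral m from sinh(pi T) = 0, and then
  sin(pi/2 (n^2 - m^2)) = 0 says that n - m is even. Evenness makes |z|^(n-m) a power of x^2 + y^2, hence
  the representation exp(ln|z| E + Arg z T) algebraic. Conversely a representation is recovered from its
  differential by its exponential series; rho(exp(i pi)) = rho(exp(-i pi)) yields sinh(pi T) = 0, and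
  computing rho(-1) from the weights and from T yields the parity condition.
*)
theory Submission
  imports Defs "HOL-Computational_Algebra.Fundamental_Theorem_Algebra"
begin

section \<open>Finite-dimensional normed spaces\<close>

text \<open>The ground field is real while the eigenvalues of \<open>T\<close> are imaginary, and
  this shapes the argument. No complexification is formed: a complex eigenvector is replaced by a
  pair of real vectors \<open>v\<close>, \<open>w\<close> on whose span a complex number acts, and
  the real and imaginary parts of a complex power series become the coefficients of \<open>v\<close>
  and \<open>w\<close>. Diagonalizability is expressed as spanning by such vectors, so a linear
  identity only has to be checked on them. The criterion for entire functions is applied to
  operators with real spectrum, hence the detour through \<open>- T\<^sup>2\<close> for
  \<open>sinh\<close>. The third equation sees \<open>n\<^sup>2 - m\<^sup>2\<close> because
  \<open>T\<^sup>2\<close> acts as \<open>- m\<^sup>2\<close>; squaring keeps parity, and among the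
  integers \<open>sin (pi / 2 * x)\<close> vanishes exactly at the even ones. The topology of
  \<open>V\<close> comes from an arbitrary norm, so continuity of linear maps and convergence of
  series are obtained from coordinates.\<close>

text \<open>The coefficient of a new vector \<open>b\<close> is controlled by the distance
  \<open>d\<close> from \<open>b\<close> to the old span, which is positive because that span is
  complete and hence closed. A Cauchy sequence therefore has Cauchy coefficients along
  \<open>b\<close>, and what remains is a Cauchy sequence in the old span.\<close>

lemma complete_span_finite:
  fixes B :: "'a::real_normed_vector set"
  assumes "finite B"
  shows "complete (span B)"
  using assms
proof (induction B rule: finite_induct)
  case empty
  then show ?case by (simp add: compact_imp_complete)
next
  case (insert b B)
  show ?case
  proof (cases "b \<in> span B")
    case True
    then show ?thesis using insert.IH by (simp add: span_redundant)
  next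
    case False
    define d where "d = infdist b (span B)"
    have "closed (span B)" using insert.IH by (rule complete_imp_closed)
    then have d: "d > 0"
      unfolding d_def using False span_zero[of B] by (intro infdist_pos_not_in_closed) auto
    have coeff: "\<bar>c\<bar> * d \<le> norm (f + c *\<^sub>R b)" if f: "f \<in> span B" for f c
    proof (cases "c = 0")
      case False
      have "- (1 / c) *\<^sub>R f \<in> span B" using f by (rule span_scale)
      then have "d \<le> dist b (- (1 / c) *\<^sub>R f)" unfolding d_def by (rule infdist_le)
      also have "\<dots> = norm ((1 / c) *\<^sub>R (f + c *\<^sub>R b))"
        using False by (simp add: dist_norm scaleR_add_right add.commute)
      also have "\<dots> = norm (f + c *\<^sub>R b) / \<bar>c\<bar>" by simp
      finally show ?thesis using False by (simp add: field_simps)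
    qed simp
    show ?thesis
      unfolding complete_def
    proof (intro allI impI, elim conjE)
      fix X :: "nat \<Rightarrow> 'a"
      assume X: "\<forall>n. X n \<in> span (insert b B)" and "Cauchy X"
      have "\<forall>n. \<exists>k. X n - k *\<^sub>R b \<in> span B"
        using X by (auto simp only: span_breakdown_eq)
      then have "\<exists>c. \<forall>n. X n - c n *\<^sub>R b \<in> span B" by (rule choice)
      then obtain c where c: "\<And>n. X n - c n *\<^sub>R b \<in> span B" by blast
      have "\<bar>c m - c n\<bar> * d \<le> dist (X m) (X n)" for m n
      proof -
        have "(X m - c m *\<^sub>R b) - (X n - c n *\<^sub>R b) \<in> span B"
          using c[of m] c[of n] by (rule span_diff)
        from coeff[OF this, of "c m - c n"] show ?thesis
          by (simp add: dist_norm algebra_simps)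
      qed
      then have cd: "dist (c m) (c n) \<le> dist (X m) (X n) / d" for m n
        using d by (simp add: dist_real_def field_simps)
      have "Cauchy c"
      proof (rule metric_CauchyI)
        fix e :: real assume "e > 0"
        then have "e * d > 0" using d by simp
        then obtain M where "\<forall>m\<ge>M. \<forall>n\<ge>M. dist (X m) (X n) < e * d"
          using \<open>Cauchy X\<close> metric_CauchyD by blast
        then have "\<forall>m\<ge>M. \<forall>n\<ge>M. dist (c m) (c n) < e"
          using cd d by (meson order_le_less_trans pos_divide_less_eq)
        then show "\<exists>M. \<forall>m\<ge>M. \<forall>n\<ge>M. dist (c m) (c n) < e" by blast
      qed
      then obtain c' where c': "c \<longlonglongrightarrow> c'" using Cauchy_convergent_iff convergent_def by blast
      then have cb: "(\<lambda>n. c n *\<^sub>R b) \<longlonglongrightarrow> c' *\<^sub>R b" by (intro tendsto_intros)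
      then have "Cauchy (\<lambda>n. X n - c n *\<^sub>R b)"
      proof (intro metric_CauchyI)
        fix e :: real assume "e > 0"
        then have "e / 2 > 0" by simp
        obtain M where M: "\<forall>m\<ge>M. \<forall>n\<ge>M. dist (X m) (X n) < e / 2"
          using metric_CauchyD[OF \<open>Cauchy X\<close> \<open>e / 2 > 0\<close>] by blast
        obtain N where N: "\<forall>m\<ge>N. \<forall>n\<ge>N. dist (c m *\<^sub>R b) (c n *\<^sub>R b) < e / 2"
          using metric_CauchyD[OF LIMSEQ_imp_Cauchy[OF cb] \<open>e / 2 > 0\<close>] by blast
        have "dist (X m - c m *\<^sub>R b) (X n - c n *\<^sub>R b) < e" if "m \<ge> max M N" "n \<ge> max M N" for m n
        proof -
          have "dist (X m - c m *\<^sub>R b) (X n - c n *\<^sub>R b)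
              \<le> dist (X m) (X n) + dist (c m *\<^sub>R b) (c n *\<^sub>R b)"
            using norm_triangle_ineq4[of "X m - X n" "c m *\<^sub>R b - c n *\<^sub>R b"]
            by (simp add: dist_norm algebra_simps)
          also have "\<dots> < e / 2 + e / 2" using M N that by (intro add_strict_mono) auto
          finally show ?thesis by simp
        qed
        then show "\<exists>M. \<forall>m\<ge>M. \<forall>n\<ge>M. dist (X m - c m *\<^sub>R b) (X n - c n *\<^sub>R b) < e" by blast
      qed
      then obtain f where f: "f \<in> span B" "(\<lambda>n. X n - c n *\<^sub>R b) \<longlonglongrightarrow> f"
        using insert.IH[unfolded complete_def, rule_format, of "\<lambda>n. X n - c n *\<^sub>R b"] c by auto
      have "(\<lambda>n. (X n - c n *\<^sub>R b) + c n *\<^sub>R b) \<longlonglongrightarrow> f + c' *\<^sub>R b"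
        using f(2) cb by (intro tendsto_add)
      moreover have "f + c' *\<^sub>R b \<in> span (insert b B)"
        using f(1) by (intro span_add span_scale) (auto simp: span_base intro: span_mono[THEN subsetD, OF subset_insertI])
      ultimately show "\<exists>l\<in>span (insert b B). X \<longlonglongrightarrow> l" by auto
    qed
  qed
qed

lemma finite_dimensional_independent_finite:
  assumes "finite_dimensional_space TYPE('v::real_normed_vector)" and "independent (C :: 'v set)"
  shows "finite C"
proof -
  obtain B :: "'v set" where "finite B" "span B = UNIV"
    using assms(1) unfolding finite_dimensional_space_def by blast
  with assms(2) show ?thesis using independent_span_bound[of B C] by auto
qed

lemma finite_dimensional_finite_spanning_subset:
  assumes "finite_dimensional_space TYPE('v::real_normed_vector)"
  obtains Y :: "'v::real_normed_vector set" where "Y \<subseteq> X" "finite Y" "independent Y" "span Y = span (X :: 'v set)"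
proof -
  obtain Y where Y: "Y \<subseteq> X" "independent Y" "X \<subseteq> span Y"
    using maximal_independent_subset[of X] by blast
  moreover have "span Y = span X"
    using Y span_mono[of Y X] span_mono[of X "span Y"] by (simp add: span_span subset_antisym)
  ultimately show ?thesis
    using that finite_dimensional_independent_finite[OF assms] by blast
qed

lemma finite_dimensional_closed_subspace:
  assumes "finite_dimensional_space TYPE('v::real_normed_vector)" and "subspace (U :: 'v set)"
  shows "closed U"
proof -
  obtain Y where "finite Y" "span Y = span U"
    using finite_dimensional_finite_spanning_subset[OF assms(1)] by metis
  then show ?thesis
    using complete_span_finite[of Y] assms(2) complete_imp_closed by (metis span_eq_iff)
qed

text \<open>The kernel is a subspace, hence closed, so a vector \<open>a\<close> with
  \<open>\<phi> a = 1\<close> has positive distance \<open>d\<close> from it. For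
  \<open>\<phi> x \<noteq> 0\<close> the vector \<open>a - (1 / \<phi> x) *\<^sub>R x\<close> lies
  in the kernel, which gives the bound \<open>1 / d\<close>.\<close>

lemma finite_dimensional_linear_functional_bounded:
  fixes \<phi> :: "'v::real_normed_vector \<Rightarrow> real"
  assumes "finite_dimensional_space TYPE('v)" and "linear \<phi>"
  shows "bounded_linear \<phi>"
proof (cases "\<forall>x. \<phi> x = 0")
  case True
  then have "\<phi> = (\<lambda>x. 0)" by auto
  then show ?thesis by simp
next
  case False
  interpret \<phi>: linear \<phi> by fact
  obtain a0 where "\<phi> a0 \<noteq> 0" using False by blast
  define a where "a = (1 / \<phi> a0) *\<^sub>R a0"
  have a: "\<phi> a = 1" using \<open>\<phi> a0 \<noteq> 0\<close> by (simp add: a_def \<phi>.scale)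
  define K where "K = {x. \<phi> x = 0}"
  have "subspace K" unfolding K_def using assms(2) by (rule linear_subspace_kernel)
  then have "closed K" by (rule finite_dimensional_closed_subspace[OF assms(1)])
  define d where "d = infdist a K"
  have d: "d > 0"
    unfolding d_def using a \<open>closed K\<close> \<phi>.zero
    by (intro infdist_pos_not_in_closed) (auto simp: K_def intro: exI[of _ 0])
  have "norm (\<phi> x) \<le> norm x * (1 / d)" for x
  proof (cases "\<phi> x = 0")
    case False
    have "a - (1 / \<phi> x) *\<^sub>R x \<in> K" using False a by (simp add: K_def \<phi>.diff \<phi>.scale)
    then have "d \<le> dist a (a - (1 / \<phi> x) *\<^sub>R x)" unfolding d_def by (rule infdist_le)
    also have "\<dots> = norm x / \<bar>\<phi> x\<bar>" by (simp add: dist_norm)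
    finally show ?thesis using False d by (simp add: field_simps)
  qed (use d in simp)
  then show ?thesis by (intro bounded_linear_intro[where K = "1 / d"]) (auto simp: \<phi>.add \<phi>.scale)
qed

text \<open>Stands in for an orthonormal basis: with continuous coordinates, boundedness,
  summability and differentiability in \<open>V\<close> reduce to statements about real
  functions.\<close>

lemma finite_dimensional_coordinates:
  assumes "finite_dimensional_space TYPE('v::real_normed_vector)"
  obtains B :: "'v::real_normed_vector set" and \<phi> :: "'v::real_normed_vector \<Rightarrow> 'v \<Rightarrow> real"
    where "finite B" "\<And>b. bounded_linear (\<phi> b)" "\<And>x. x = (\<Sum>b\<in>B. \<phi> b x *\<^sub>R b)"
proof -
  obtain B :: "'v set" where B: "finite B" "independent B" "span B = UNIV"
    using finite_dimensional_finite_spanning_subset[OF assms, of UNIV] by (metis span_UNIV)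
  have "linear (\<lambda>x. representation B x b)" for b
    using B by (intro linearI) (auto simp: representation_add representation_scale)
  then have "bounded_linear (\<lambda>x. representation B x b)" for b
    by (rule finite_dimensional_linear_functional_bounded[OF assms])
  moreover have "x = (\<Sum>b\<in>B. representation B x b *\<^sub>R b)" for x
    using B by (simp add: sum_representation_eq)
  ultimately show ?thesis using that[of B "\<lambda>b x. representation B x b"] B(1) by blast
qed

lemma finite_dimensional_linear_bounded:
  fixes f :: "'v::real_normed_vector \<Rightarrow> 'w::real_normed_vector"
  assumes "finite_dimensional_space TYPE('v)" and "linear f"
  shows "bounded_linear f"
proof -
  obtain B :: "'v set" and \<phi> where B: "finite B" "\<And>b. bounded_linear (\<phi> b)"
    "\<And>x. x = (\<Sum>b\<in>B. \<phi> b x *\<^sub>R b)"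
    using finite_dimensional_coordinates[OF assms(1)] by blast
  have "f x = (\<Sum>b\<in>B. \<phi> b x *\<^sub>R f b)" for x
  proof -
    have "f x = f (\<Sum>b\<in>B. \<phi> b x *\<^sub>R b)" by (simp flip: B(3))
    also have "\<dots> = (\<Sum>b\<in>B. \<phi> b x *\<^sub>R f b)" using assms(2) by (simp add: linear_sum linear_cmul)
    finally show ?thesis .
  qed
  then have f: "f = (\<lambda>x. \<Sum>b\<in>B. \<phi> b x *\<^sub>R f b)" by (rule ext)
  have "bounded_linear (\<lambda>x. \<Sum>b\<in>B. \<phi> b x *\<^sub>R f b)"
    using B(2) by (intro bounded_linear_sum bounded_linear_scaleR_const)
  then show ?thesis by (subst f)
qed

section \<open>Series in a finite-dimensional space\<close>

lemma finite_dimensional_sums: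
  fixes x :: "nat \<Rightarrow> 'v::real_normed_vector"
  assumes "finite_dimensional_space TYPE('v)"
    and "\<And>\<phi> :: 'v \<Rightarrow> real. bounded_linear \<phi> \<Longrightarrow> (\<lambda>k. \<phi> (x k)) sums \<phi> l"
  shows "x sums l"
proof -
  obtain B :: "'v set" and \<phi> where B: "finite B" "\<And>b. bounded_linear (\<phi> b)"
    "\<And>x. x = (\<Sum>b\<in>B. \<phi> b x *\<^sub>R b)"
    using finite_dimensional_coordinates[OF assms(1)] by blast
  have "(\<lambda>k. \<Sum>b\<in>B. \<phi> b (x k) *\<^sub>R b) sums (\<Sum>b\<in>B. \<phi> b l *\<^sub>R b)"
    using B(2) assms(2) by (intro sums_sum sums_scaleR_left) auto
  then show ?thesis by (simp flip: B(3))
qed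

lemma linear_funpow:
  assumes "linear (A :: 'a::real_vector \<Rightarrow> 'a)"
  shows "linear (A ^^ k)"
proof (induction k)
  case (Suc k)
  then show ?case using linear_compose[OF Suc assms] by (simp add: o_def)
qed (simp add: linear_id[unfolded id_def] id_def)

lemma finite_dimensional_funpow_bound:
  fixes A :: "'v::real_normed_vector \<Rightarrow> 'v"
  assumes "finite_dimensional_space TYPE('v)" and "linear A"
  obtains K where "K \<ge> 0" "\<And>k v. norm ((A ^^ k) v) \<le> K ^ k * norm v"
proof -
  have "bounded_linear A" by (rule finite_dimensional_linear_bounded[OF assms])
  then obtain K where K: "K \<ge> 0" "\<And>v. norm (A v) \<le> norm v * K"
    using bounded_linear.nonneg_bounded by blast
  have "norm ((A ^^ k) v) \<le> K ^ k * norm v" for k v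
  proof (induction k)
    case (Suc k)
    have "norm ((A ^^ Suc k) v) \<le> norm ((A ^^ k) v) * K" using K(2) by simp
    also have "\<dots> \<le> K ^ k * norm v * K" using Suc K(1) by (rule mult_right_mono)
    finally show ?case by (simp add: mult_ac)
  qed simp
  then show ?thesis using that K(1) by blast
qed

text \<open>The comparison test wants a complete target, whereas \<open>'v\<close> is only known to
  be normed; it is therefore applied to the real coordinates of the terms.\<close>

lemma finite_dimensional_power_series_summable:
  fixes A :: "'v::real_normed_vector \<Rightarrow> 'v" and c :: "nat \<Rightarrow> real"
  assumes fd: "finite_dimensional_space TYPE('v)" and "linear A"
    and c: "\<And>r. r \<ge> 0 \<Longrightarrow> summable (\<lambda>k. \<bar>c k\<bar> * r ^ k)"
  shows "summable (\<lambda>k. c k *\<^sub>R (A ^^ k) v)"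
proof -
  obtain B :: "'v set" and \<phi> where B: "finite B" "\<And>b. bounded_linear (\<phi> b)"
    "\<And>x. x = (\<Sum>b\<in>B. \<phi> b x *\<^sub>R b)"
    using finite_dimensional_coordinates[OF fd] by blast
  obtain K where K: "K \<ge> 0" "\<And>k v. norm ((A ^^ k) v) \<le> K ^ k * norm v"
    using finite_dimensional_funpow_bound[OF fd \<open>linear A\<close>] by blast
  have "summable (\<lambda>k. \<phi> b (c k *\<^sub>R (A ^^ k) v))" for b
  proof -
    interpret b: bounded_linear "\<phi> b" by (rule B(2))
    obtain L where L: "L \<ge> 0" "\<And>v. norm (\<phi> b v) \<le> norm v * L" using b.nonneg_bounded by blast
    show ?thesis
    proof (rule summable_comparison_test')
      show "summable (\<lambda>k. \<bar>c k\<bar> * K ^ k * (norm v * L))" using c[OF K(1)] by (rule summable_mult2)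
      show "norm (\<phi> b (c k *\<^sub>R (A ^^ k) v)) \<le> \<bar>c k\<bar> * K ^ k * (norm v * L)" if "k \<ge> 0" for k
      proof -
        have "norm (\<phi> b (c k *\<^sub>R (A ^^ k) v)) = \<bar>c k\<bar> * norm (\<phi> b ((A ^^ k) v))"
          by (simp add: b.scaleR abs_mult)
        also have "\<dots> \<le> \<bar>c k\<bar> * (norm ((A ^^ k) v) * L)" using L by (intro mult_left_mono) auto
        also have "\<dots> \<le> \<bar>c k\<bar> * ((K ^ k * norm v) * L)"
          using K L by (intro mult_left_mono mult_right_mono) auto
        finally show ?thesis by (simp add: mult_ac)
      qed
    qed
  qed
  then have "summable (\<lambda>k. \<Sum>b\<in>B. \<phi> b (c k *\<^sub>R (A ^^ k) v) *\<^sub>R b)"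
    by (intro summable_sum) (auto intro!: bounded_linear.summable[OF bounded_linear_scaleR_left])
  then show ?thesis by (simp flip: B(3))
qed


section \<open>Power series of an endomorphism\<close>

definition poly_act :: "real poly \<Rightarrow> ('v::real_vector \<Rightarrow> 'v) \<Rightarrow> 'v \<Rightarrow> 'v" where
  "poly_act p A v = (\<Sum>k\<le>degree p. coeff p k *\<^sub>R (A ^^ k) v)"

lemma poly_act_0 [simp]: "poly_act 0 A v = 0"
  by (simp add: poly_act_def)

lemma poly_act_pCons:
  assumes "linear A"
  shows "poly_act (pCons a p) A v = a *\<^sub>R v + A (poly_act p A v)"
proof (cases "p = 0")
  case False
  have "A (poly_act p A v) = (\<Sum>k\<le>degree p. coeff p k *\<^sub>R (A ^^ Suc k) v)"
    using assms by (simp add: poly_act_def linear_sum linear_cmul)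
  then show ?thesis
    using False by (simp add: poly_act_def sum.atMost_Suc_shift del: sum.atMost_Suc)
qed (use linear_0[OF assms] in \<open>simp add: poly_act_def\<close>)

lemma poly_act_add:
  assumes "linear A"
  shows "poly_act (p + q) A v = poly_act p A v + poly_act q A v"
  using assms
  by (induction p q rule: poly_induct2)
    (simp_all add: poly_act_pCons linear_add scaleR_add_left algebra_simps)

lemma poly_act_smult:
  assumes "linear A"
  shows "poly_act (smult c p) A v = c *\<^sub>R poly_act p A v"
  using assms
  by (induction p) (simp_all add: poly_act_pCons linear_cmul scaleR_add_right)

lemma poly_act_mult:
  assumes "linear A"
  shows "poly_act (p * q) A v = poly_act p A (poly_act q A v)"
  using assms
  by (induction p) (simp_all add: poly_act_pCons poly_act_add poly_act_smult linear_add linear_0)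

text \<open>An annihilator of the single vector \<open>v\<close> is enough, because spanning is
  later proved one vector at a time. Either two iterates of \<open>v\<close> coincide and a
  difference of two monomials works, or the iterates form an infinite, hence dependent, set.\<close>

lemma finite_dimensional_annihilating_poly:
  fixes A :: "'v::real_normed_vector \<Rightarrow> 'v"
  assumes fd: "finite_dimensional_space TYPE('v)" and "linear A"
  obtains p where "p \<noteq> 0" "poly_act p A v = 0"
proof -
  define f where "f k = (A ^^ k) v" for k
  have "\<exists>c n. (\<exists>k\<le>n. c k \<noteq> (0::real)) \<and> (\<Sum>k\<le>n. c k *\<^sub>R f k) = 0"
  proof (cases "inj f")
    case False
    then obtain i j where ij: "i < j" "f i = f j" by (metis injI linorder_neqE_nat)
    have "(\<Sum>k\<le>j. ((if k = j then 1 else 0) - (if k = i then 1 else 0)) *\<^sub>R f k)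
        = (\<Sum>k\<le>j. (if k = j then f k else 0)) - (\<Sum>k\<le>j. (if k = i then f k else 0))"
      by (simp add: scaleR_diff_left sum_subtractf if_distrib[of "\<lambda>c. c *\<^sub>R _"] cong: if_cong)
    also have "\<dots> = 0" using ij by simp
    finally show ?thesis
      using ij by (intro exI[of _ "\<lambda>k. (if k = j then 1 else 0) - (if k = i then 1 else 0)"] exI[of _ j])
        (auto intro!: exI[of _ j])
  next
    case True
    then have "infinite (range f)" by (simp add: finite_image_iff)
    then have "dependent (range f)"
      using finite_dimensional_independent_finite[OF fd] by blast
    then obtain S u where S: "finite S" "S \<subseteq> range f" "\<exists>x\<in>S. u x \<noteq> 0" "(\<Sum>x\<in>S. u x *\<^sub>R x) = 0"
      unfolding dependent_explicit by blast
    obtain K where K: "finite K" "S = f ` K" using S(1,2) by (metis finite_subset_image)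
    obtain n where n: "K \<subseteq> {..n}" using finite_nat_iff_bounded_le K(1) by blast
    have "(\<Sum>k\<le>n. (if k \<in> K then u (f k) else 0) *\<^sub>R f k) = (\<Sum>k\<in>K. u (f k) *\<^sub>R f k)"
      using n by (intro sum.mono_neutral_cong_right) auto
    also have "\<dots> = (\<Sum>x\<in>S. u x *\<^sub>R x)"
      using True unfolding K(2) by (subst sum.reindex) (auto simp: inj_on_def inj_def)
    finally show ?thesis
      using S(3,4) n K(2)
      by (intro exI[of _ "\<lambda>k. if k \<in> K then u (f k) else 0"] exI[of _ n]) auto
  qed
  then obtain c n where c: "\<exists>k\<le>n. c k \<noteq> (0::real)" "(\<Sum>k\<le>n. c k *\<^sub>R f k) = 0" by blast
  define p where "p = (\<Sum>k\<le>n. monom (c k) k)"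
  have coeff: "coeff p k = (if k \<le> n then c k else 0)" for k
    unfolding p_def by (simp add: coeff_sum)
  have "p \<noteq> 0" using c(1) coeff by (metis coeff_0)
  have "degree p \<le> n" using coeff by (intro degree_le) auto
  then have "poly_act p A v = (\<Sum>k\<le>n. coeff p k *\<^sub>R (A ^^ k) v)"
    unfolding poly_act_def by (intro sum.mono_neutral_left) (auto simp: coeff_eq_0)
  also have "\<dots> = 0" using c(2) by (simp add: coeff f_def)
  finally show ?thesis using that \<open>p \<noteq> 0\<close> by blast
qed

lemma poly_map_poly_of_real_add:
  fixes p q :: "real poly" and z :: complex
  shows "poly (map_poly of_real (p + q)) z = poly (map_poly of_real p) z + poly (map_poly of_real q) z"
  by (induction p q rule: poly_induct2) (simp_all add: map_poly_pCons algebra_simps)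

lemma poly_map_poly_of_real_mult:
  fixes p q :: "real poly" and z :: complex
  shows "poly (map_poly of_real (p * q)) z = poly (map_poly of_real p) z * poly (map_poly of_real q) z"
proof -
  have smult: "poly (map_poly of_real (smult c q)) z = of_real c * poly (map_poly of_real q) z"
    for c and q :: "real poly"
    by (induction q) (simp_all add: map_poly_pCons algebra_simps)
  show ?thesis
    by (induction p) (simp_all add: map_poly_pCons poly_map_poly_of_real_add smult algebra_simps)
qed

lemma poly_map_poly_of_real_of_real:
  fixes p :: "real poly"
  shows "poly (map_poly complex_of_real p) (of_real x) = of_real (poly p x)"
  by (induction p) (simp_all add: map_poly_pCons)

text \<open>The fundamental theorem of algebra provides a complex root \<open>z\<close>. If
  \<open>z\<close> is not real, the remainder of \<open>p\<close> modulo
  \<open>(X - z) (X - cnj z)\<close> has real coefficients and degree at most one, yet vanishes at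
  \<open>z\<close>, so it is zero.\<close>

lemma real_poly_linear_or_quadratic_factor:
  fixes p :: "real poly"
  assumes "degree p > 0"
  obtains a where "[:-a, 1:] dvd p"
  | a b where "b \<noteq> 0" "[:a\<^sup>2 + b\<^sup>2, -2 * a, 1:] dvd p"
proof -
  let ?c = "map_poly complex_of_real"
  have "degree (?c p) = degree p" by (simp add: degree_map_poly)
  then obtain z where z: "poly (?c p) z = 0"
    using fundamental_theorem_of_algebra[of "?c p"] assms by (auto simp: constant_degree)
  show ?thesis
  proof (cases "Im z = 0")
    case True
    then have "complex_of_real (poly p (Re z)) = 0"
      using z poly_map_poly_of_real_of_real[of p "Re z"] by (metis complex_is_Real_iff of_real_Re)
    then show ?thesis using that(1)[of "Re z"] by (simp add: poly_eq_0_iff_dvd)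
  next
    case False
    define q where "q = [:(Re z)\<^sup>2 + (Im z)\<^sup>2, -2 * Re z, 1:]"
    have "degree (p mod q) < 2" using degree_mod_less'[of q p] by (cases "p mod q = 0") (auto simp: q_def)
    then obtain c0 c1 where r: "p mod q = [:c0, c1:]" 
      by (metis One_nat_def Suc_1 degree_eq_zeroE degree1_coeffs less_2_cases pCons_0_0)
    have "poly (?c q) z = 0"
      by (simp add: q_def map_poly_pCons complex_eq_iff power2_eq_square algebra_simps)
    moreover have "poly (?c p) z = poly (?c q) z * poly (?c (p div q)) z + poly (?c (p mod q)) z"
      by (simp flip: poly_map_poly_of_real_mult poly_map_poly_of_real_add)
    ultimately have "poly (?c (p mod q)) z = 0" using z by simp
    then have "of_real c0 + z * of_real c1 = 0" by (simp add: r map_poly_pCons)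
    then have "c1 = 0" "c0 = 0" using False by (auto simp: complex_eq_iff)
    then have "q dvd p" using r by (simp add: dvd_eq_mod_eq_0)
    then show ?thesis using that(2)[of "Im z" "Re z"] False by (simp add: q_def)
  qed
qed

section \<open>Power series on eigenvectors, complex blocks and Jordan chains\<close>

lemma linear_power_series_eigenvalue:
  fixes A :: "'v::real_normed_vector \<Rightarrow> 'v"
  assumes "linear A" "A v = x *\<^sub>R v" and "(\<lambda>k. c k * x ^ k) sums f"
  shows "(\<lambda>k. c k *\<^sub>R (A ^^ k) v) sums (f *\<^sub>R v)"
proof -
  have "(A ^^ k) v = x ^ k *\<^sub>R v" for k
    using assms(1,2) by (induction k) (simp_all add: linear_cmul mult.commute)
  then show ?thesis using sums_scaleR_left[OF assms(3), of v] by simp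
qed

text \<open>Naming the sum by a linear map \<open>L\<close> makes convergence on the whole span part
  of the conclusion.\<close>

lemma linear_power_series_sums_on_span:
  fixes A :: "'v::real_normed_vector \<Rightarrow> 'v"
  assumes A: "linear A" and L: "linear L"
    and "\<And>u. u \<in> X \<Longrightarrow> (\<lambda>k. c k *\<^sub>R (A ^^ k) u) sums L u" and "v \<in> span X"
  shows "(\<lambda>k. c k *\<^sub>R (A ^^ k) v) sums L v"
  using assms(4)
proof (induction rule: span_induct_alt)
  case base
  show ?case using linear_0[OF linear_funpow[OF A]] linear_0[OF L] by simp
next
  case (step r u v)
  then have "(\<lambda>k. r *\<^sub>R (c k *\<^sub>R (A ^^ k) u) + c k *\<^sub>R (A ^^ k) v) sums (r *\<^sub>R L u + L v)"
    using assms(3) by (intro sums_add sums_scaleR_right)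
  then show ?case
    using linear_add[OF linear_funpow[OF A]] linear_cmul[OF linear_funpow[OF A]] L
    by (simp add: linear_add linear_cmul scaleR_add_right mult.commute)
qed

text \<open>With \<open>v\<close> in the role of \<open>1\<close> and \<open>w\<close> in that of
  \<open>i\<close>, \<open>A\<close> is multiplication by \<open>x + iy\<close>, so a power series
  in \<open>A\<close> is multiplication by its complex value \<open>F\<close>.\<close>

lemma linear_power_series_eigenvector:
  fixes A :: "'v::real_normed_vector \<Rightarrow> 'v"
  assumes "linear A" "A v = x *\<^sub>R v + y *\<^sub>R w" "A w = x *\<^sub>R w - y *\<^sub>R v"
    and "(\<lambda>k. c k *\<^sub>R Complex x y ^ k) sums F"
  shows "(\<lambda>k. c k *\<^sub>R (A ^^ k) v) sums (Re F *\<^sub>R v + Im F *\<^sub>R w)"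
proof -
  have pow: "(A ^^ k) v = Re (Complex x y ^ k) *\<^sub>R v + Im (Complex x y ^ k) *\<^sub>R w" for k
  proof (induction k)
    case (Suc k)
    have "(A ^^ Suc k) v = Re (Complex x y ^ k) *\<^sub>R (x *\<^sub>R v + y *\<^sub>R w) + Im (Complex x y ^ k) *\<^sub>R (x *\<^sub>R w - y *\<^sub>R v)"
      using Suc assms(1-3) by (simp add: linear_add linear_cmul)
    also have "\<dots> = Re (Complex x y ^ Suc k) *\<^sub>R v + Im (Complex x y ^ Suc k) *\<^sub>R w"
      by (simp add: algebra_simps)
    finally show ?case .
  qed simp
  have "(\<lambda>k. Re (c k *\<^sub>R Complex x y ^ k) *\<^sub>R v + Im (c k *\<^sub>R Complex x y ^ k) *\<^sub>R w)
    sums (Re F *\<^sub>R v + Im F *\<^sub>R w)"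
    by (intro sums_add sums_scaleR_left sums_Re sums_Im assms(4))
  then show ?thesis by (simp add: pow scaleR_add_right)
qed

text \<open>Put \<open>N = A - x\<close>; then \<open>N v = w\<close> and \<open>N w = 0\<close>, so
  the binomial expansion of \<open>(x + N) ^ k\<close> on \<open>v\<close> stops after the linear
  term. At \<open>k = 0\<close> the truncated exponent \<open>k - 1\<close> is masked by the factor
  \<open>k\<close>.\<close>

lemma linear_power_series_jordan:
  fixes A :: "'v::real_normed_vector \<Rightarrow> 'v"
  assumes "linear A" "A v = x *\<^sub>R v + w" "A w = x *\<^sub>R w"
    and "(\<lambda>k. c k * x ^ k) sums f" "(\<lambda>k. c k * (of_nat k * x ^ (k - 1))) sums f'"
  shows "(\<lambda>k. c k *\<^sub>R (A ^^ k) v) sums (f *\<^sub>R v + f' *\<^sub>R w)"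
proof -
  have pow: "(A ^^ k) v = x ^ k *\<^sub>R v + (of_nat k * x ^ (k - 1)) *\<^sub>R w" for k
  proof (induction k)
    case (Suc k)
    have "x * (of_nat k * x ^ (k - 1)) = of_nat k * x ^ k" by (cases k) auto
    then show ?case using assms(1-3) Suc
      by (simp add: linear_add linear_cmul algebra_simps flip: scaleR_add_left)
  qed simp
  have "(\<lambda>k. (c k * x ^ k) *\<^sub>R v + (c k * (of_nat k * x ^ (k - 1))) *\<^sub>R w) sums (f *\<^sub>R v + f' *\<^sub>R w)"
    by (intro sums_add sums_scaleR_left assms)
  then show ?thesis by (simp add: pow scaleR_add_right)
qed

text \<open>
  On a Jordan block of size two at a real zero \<open>x\<close> of \<open>F\<close>, \<open>F(A)\<close> is \<open>F'(x) (A - x)\<close>, so simple zeros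
  leave no room for nilpotents; on a two-dimensional block belonging to a nonreal number, where \<open>F\<close>
  does not vanish, \<open>F(A)\<close> is invertible. Both blocks are split off one factor of an annihilating
  polynomial at a time. The subspace \<open>U\<close> allows the result to be applied to one eigenspace of a
  commuting endomorphism.
\<close>

lemma power_series_annihilates_imp_diagonalizable:
  fixes A :: "'v::real_normed_vector \<Rightarrow> 'v" and c :: "nat \<Rightarrow> real" and F :: "complex \<Rightarrow> complex"
  assumes fd: "finite_dimensional_space TYPE('v)" and A: "linear A"
    and U: "subspace U" "\<And>u. u \<in> U \<Longrightarrow> A u \<in> U"
    and F: "\<And>z. (\<lambda>k. c k *\<^sub>R z ^ k) sums F z"
    and real_zeros: "\<And>z. F z = 0 \<Longrightarrow> Im z = 0"
    and simple_zeros: "\<And>x::real. F (of_real x) = 0 \<Longrightarrow>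
      \<exists>d. d \<noteq> 0 \<and> (\<lambda>k. c k * (of_nat k * x ^ (k - 1))) sums d"
    and vanish: "\<And>u. u \<in> U \<Longrightarrow> (\<lambda>k. c k *\<^sub>R (A ^^ k) u) sums 0"
    and "v \<in> U"
  shows "v \<in> span {u \<in> U. \<exists>x::real. F (of_real x) = 0 \<and> A u = x *\<^sub>R u}"
proof -
  let ?X = "{u \<in> U. \<exists>x::real. F (of_real x) = 0 \<and> A u = x *\<^sub>R u}"
  have X_U: "span ?X \<subseteq> U" using U(1) by (intro span_minimal) auto
  have F_real: "F (of_real x) = of_real (Re (F (of_real x)))"
    and F_Re: "(\<lambda>k. c k * x ^ k) sums Re (F (of_real x))" for x
  proof -
    have "(\<lambda>k. Im (c k *\<^sub>R complex_of_real x ^ k)) sums Im (F (of_real x))"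
      by (rule sums_Im[OF F])
    then have "(\<lambda>k. 0) sums Im (F (of_real x))" by (simp flip: of_real_power)
    then have "Im (F (of_real x)) = 0" using sums_zero sums_unique2 by blast
    then show "F (of_real x) = of_real (Re (F (of_real x)))" by (simp add: complex_eq_iff)
    show "(\<lambda>k. c k * x ^ k) sums Re (F (of_real x))"
      using sums_Re[OF F[of "of_real x"]] by (simp flip: of_real_power)
  qed
  have eigen_0: "u = 0" if "u \<in> U" "A u = a *\<^sub>R u" "F (of_real a) \<noteq> 0" for u a
  proof -
    have "(\<lambda>k. c k *\<^sub>R (A ^^ k) u) sums (Re (F (of_real a)) *\<^sub>R u)"
      using A that(2) F_Re by (rule linear_power_series_eigenvalue)
    then have "Re (F (of_real a)) *\<^sub>R u = 0"
      using vanish[OF that(1)] sums_unique2 by fastforce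
    then show ?thesis using that(3) F_real[of a] by (metis of_real_0 scaleR_eq_0_iff)
  qed
  have "v \<in> span ?X" if "p \<noteq> 0" "poly_act p A v = 0" "v \<in> U" for p v
    using that
  proof (induction "degree p" arbitrary: p v rule: less_induct)
    case less
    show ?case
    proof (cases "degree p = 0")
      case True
      then obtain c0 where "p = [:c0:]" by (rule degree_eq_zeroE)
      then have "v = 0" using less.prems A by (simp add: poly_act_pCons linear_0)
      then show ?thesis by (simp add: span_zero)
    next
      case False
      then have "degree p > 0" by simp
      then show ?thesis
      proof (cases p rule: real_poly_linear_or_quadratic_factor)
        case (1 a)
        then obtain q where q: "p = [:-a, 1:] * q" by (rule dvdE)
        define w where "w = A v - a *\<^sub>R v"
        have "w = poly_act [:-a, 1:] A v" using A by (simp add: w_def poly_act_pCons linear_0)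
        then have "poly_act q A w = 0"
          using less.prems(2) q A by (metis mult.commute poly_act_mult)
        moreover have "q \<noteq> 0" "degree q < degree p"
          using q less.prems(1) by (auto simp: degree_mult_eq simp del: mult_pCons_left)
        moreover have "w \<in> U" using U less.prems(3) by (simp add: w_def subspace_diff subspace_scale)
        ultimately have "w \<in> span ?X" using less.hyps by blast
        \<comment> \<open>\<open>A - a\<close> is invertible on eigenvectors with eigenvalue
          \<open>b \<noteq> a\<close>, so \<open>w\<close> lies in its image up to an eigenvector
          \<open>y\<close> for \<open>a\<close>. Subtracting \<open>x\<close> from \<open>v\<close>
          then leaves \<open>v'\<close> with \<open>(A - a) v' = y\<close>, a Jordan chain of length
          at most two.\<close>
        then have "\<exists>x y. x \<in> span ?X \<and> y \<in> U \<and> A y = a *\<^sub>R y \<and> w = A x - a *\<^sub>R x + y"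
        proof (induction rule: span_induct_alt)
          case base
          show ?case using U A by (intro exI[of _ 0]) (simp add: span_zero subspace_0 linear_0)
        next
          case (step r u w)
          then obtain x y b where *: "x \<in> span ?X" "y \<in> U" "A y = a *\<^sub>R y" "w = A x - a *\<^sub>R x + y"
            "u \<in> U" "A u = b *\<^sub>R u" by blast
          show ?case
          proof (cases "b = a")
            case True
            then show ?thesis using * U A
              by (intro exI[of _ x] exI[of _ "r *\<^sub>R u + y"])
                (simp add: subspace_add subspace_scale linear_add linear_cmul algebra_simps)
          next
            case False
            have "A (k *\<^sub>R u) - a *\<^sub>R k *\<^sub>R u = (k * (b - a)) *\<^sub>R u" for k
              using *(6) A by (simp add: linear_cmul algebra_simps)
            then have "A ((r / (b - a)) *\<^sub>R u) - a *\<^sub>R (r / (b - a)) *\<^sub>R u = (r / (b - a) * (b - a)) *\<^sub>R u" .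
            also have "\<dots> = r *\<^sub>R u" using False by simp
            finally have "r *\<^sub>R u + w = A ((r / (b - a)) *\<^sub>R u + x) - a *\<^sub>R ((r / (b - a)) *\<^sub>R u + x) + y"
              using *(4) A by (simp add: linear_add scaleR_add_right)
            moreover have "(r / (b - a)) *\<^sub>R u + x \<in> span ?X"
              by (rule span_add[OF span_scale[OF span_base[OF step.hyps(1)]] *(1)])
            ultimately show ?thesis using *(2,3) by blast
          qed
        qed
        then obtain x y where xy: "x \<in> span ?X" "y \<in> U" "A y = a *\<^sub>R y" "w = A x - a *\<^sub>R x + y"
          by blast
        define v' where "v' = v - x"
        have v'U: "v' \<in> U" using xy(1) X_U less.prems(3) U(1) by (auto simp: v'_def intro: subspace_diff)
        have Av': "A v' = a *\<^sub>R v' + y"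
          using xy(4) A by (simp add: v'_def w_def linear_diff algebra_simps)
        have "v' \<in> span ?X"
        proof (cases "F (of_real a) = 0")
          case True
          then obtain d where d: "d \<noteq> 0" "(\<lambda>k. c k * (of_nat k * a ^ (k - 1))) sums d"
            using simple_zeros by blast
          have "(\<lambda>k. c k *\<^sub>R (A ^^ k) v') sums (Re (F (of_real a)) *\<^sub>R v' + d *\<^sub>R y)"
            using A Av' xy(3) F_Re d(2) by (rule linear_power_series_jordan)
          then have "y = 0" using vanish[OF v'U] d(1) True sums_unique2 by fastforce
          then have "v' \<in> ?X" using v'U Av' True by auto
          then show ?thesis by (rule span_base)
        next
          case False
          then have "y = 0" using eigen_0 xy by blast
          then have "v' = 0" using eigen_0[OF v'U _ False] Av' by simp
          then show ?thesis by (simp add: span_zero)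
        qed
        then have "v' + x \<in> span ?X" using xy(1) by (rule span_add)
        then show ?thesis by (simp add: v'_def)
      next
        case (2 a b)
        then obtain q where q: "p = [:a\<^sup>2 + b\<^sup>2, -2 * a, 1:] * q" by (meson dvdE)
        define Q where "Q u = (a\<^sup>2 + b\<^sup>2) *\<^sub>R u - (2 * a) *\<^sub>R A u + A (A u)" for u
        have Q: "Q (r *\<^sub>R u + u') = r *\<^sub>R Q u + Q u'" for r u u'
          using A by (simp add: Q_def linear_add linear_cmul algebra_simps)
        have "Q v = poly_act [:a\<^sup>2 + b\<^sup>2, -2 * a, 1:] A v"
          using A by (simp add: Q_def poly_act_pCons linear_0 linear_add linear_cmul linear_diff)
        then have "poly_act q A (Q v) = 0"
          using less.prems(2) q A by (metis mult.commute poly_act_mult)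
        moreover have "q \<noteq> 0" "degree q < degree p"
          using q less.prems(1) by (auto simp: degree_mult_eq simp del: mult_pCons_left)
        moreover have "Q v \<in> U" using U less.prems(3)
          by (simp add: Q_def subspace_add subspace_diff subspace_scale)
        ultimately have "Q v \<in> span ?X" using less.hyps by blast
        \<comment> \<open>On an eigenvector with real eigenvalue \<open>t\<close>, \<open>Q\<close>
          is the scalar \<open>(t - a)\<^sup>2 + b\<^sup>2\<close>, nonzero since
          \<open>b \<noteq> 0\<close>; hence \<open>Q\<close> maps the span onto itself, and
          \<open>v\<close> can be corrected by \<open>x\<close> to lie in the kernel of
          \<open>Q\<close>.\<close>
        then have "\<exists>x. x \<in> span ?X \<and> Q v = Q x"
        proof (induction rule: span_induct_alt)
          case base
          show ?case using A by (intro exI[of _ 0]) (simp add: Q_def span_zero linear_0)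
        next
          case (step r u w)
          then obtain x t where *: "x \<in> span ?X" "w = Q x" "A u = t *\<^sub>R u" by blast
          define s where "s = (t - a)\<^sup>2 + b\<^sup>2"
          have "s \<noteq> 0" using 2(1) by (simp add: s_def sum_power2_eq_zero_iff)
          have "Q u = s *\<^sub>R u"
            using * A by (simp add: Q_def s_def linear_cmul power2_eq_square algebra_simps)
          then have "r *\<^sub>R u + w = Q ((r / s) *\<^sub>R u + x)" using * \<open>s \<noteq> 0\<close> by (simp add: Q)
          moreover have "(r / s) *\<^sub>R u + x \<in> span ?X"
            by (rule span_add[OF span_scale[OF span_base[OF step.hyps(1)]] *(1)])
          ultimately show ?case by blast
        qed
        then obtain x where x: "x \<in> span ?X" "Q v = Q x" by blast
        define v' where "v' = v - x"
        \<comment> \<open>On the kernel of \<open>Q = (A - a)\<^sup>2 + b\<^sup>2\<close> the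
          operator \<open>(A - a) / b\<close> squares to \<open>- 1\<close>; it is a complex
          structure, and \<open>w\<close> is \<open>i\<close> times \<open>v'\<close>.\<close>
        define w where "w = (1 / b) *\<^sub>R (A v' - a *\<^sub>R v')"
        have v'U: "v' \<in> U" using x(1) X_U less.prems(3) U(1) by (auto simp: v'_def intro: subspace_diff)
        then have wU: "w \<in> U" using U by (simp add: w_def subspace_diff subspace_scale)
        have "Q v' = 0" using Q[of "-1" x v] x(2) by (simp add: v'_def)
        moreover have "(2 * a) *\<^sub>R A v' = a *\<^sub>R A v' + a *\<^sub>R A v'"
          unfolding mult_2 by (rule scaleR_left_distrib)
        ultimately have AA: "A (A v') - a *\<^sub>R A v' = a *\<^sub>R A v' - (a\<^sup>2 + b\<^sup>2) *\<^sub>R v'"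
          by (simp add: Q_def algebra_simps)
        have Av': "A v' = a *\<^sub>R v' + b *\<^sub>R w" using 2(1) by (simp add: w_def)
        have AA': "A (A v') - a *\<^sub>R A v' = (a * b) *\<^sub>R w - (b * b) *\<^sub>R v'"
          unfolding AA unfolding Av' by (simp add: power2_eq_square algebra_simps)
        have "A w = (1 / b) *\<^sub>R (A (A v') - a *\<^sub>R A v')"
          using A by (simp add: w_def linear_cmul linear_diff)
        also have "\<dots> = a *\<^sub>R w - b *\<^sub>R v'" unfolding AA' using 2(1) by (simp add: scaleR_diff_right)
        finally have Aw: "A w = a *\<^sub>R w - b *\<^sub>R v'" .
        define f where "f = F (Complex a b)"
        have f: "(\<lambda>k. c k *\<^sub>R Complex a b ^ k) sums f" unfolding f_def by (rule F)
        have "f \<noteq> 0" using real_zeros[of "Complex a b"] 2(1) by (auto simp: f_def)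
        have "Re f *\<^sub>R v' + Im f *\<^sub>R w = 0"
          using linear_power_series_eigenvector[OF A Av' Aw f] vanish[OF v'U] sums_unique2 by blast
        \<comment> \<open>The pair \<open>(w, - v')\<close> is \<open>i\<close> times the pair
          \<open>(v', w)\<close> and satisfies the same relations. Combining the two equations with
          the coefficients of the conjugate of \<open>f\<close> eliminates \<open>w\<close> and
          leaves \<open>|f|^2\<close> times \<open>v'\<close>.\<close>
        moreover have "Re f *\<^sub>R w + Im f *\<^sub>R (- v') = 0"
          using linear_power_series_eigenvector[OF A _ _ f, of w "- v'"] vanish[OF wU] sums_unique2 A Av' Aw
          by (fastforce simp: linear_neg)
        ultimately have "Re f *\<^sub>R (Re f *\<^sub>R v' + Im f *\<^sub>R w) - Im f *\<^sub>R (Re f *\<^sub>R w + Im f *\<^sub>R (- v')) = 0"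
          by simp
        then have "((Re f)\<^sup>2 + (Im f)\<^sup>2) *\<^sub>R v' = 0"
          by (simp add: power2_eq_square algebra_simps)
        then have "v' = 0" using \<open>f \<noteq> 0\<close> by (auto simp: sum_power2_eq_zero_iff complex_eq_iff)
        then show ?thesis using x(1) by (simp add: v'_def)
      qed
    qed
  qed
  moreover obtain p where "p \<noteq> 0" "poly_act p A v = 0"
    by (rule finite_dimensional_annihilating_poly[OF fd A])
  ultimately show ?thesis using \<open>v \<in> U\<close> by blast
qed


section \<open>Spectra of Hodge pairs\<close>

text \<open>Each derivative advances the phase by a quarter period, so one formula covers all
  residues of \<open>k\<close> modulo four.\<close>

lemma funpow_deriv_sin_scaled:
  "(deriv ^^ k) (\<lambda>x::real. sin (c * x)) = (\<lambda>x. c ^ k * sin (c * x + real k * pi / 2))"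
proof (induction k)
  case (Suc k)
  have "deriv (\<lambda>x. c ^ k * sin (c * x + real k * pi / 2)) x
      = c ^ Suc k * sin (c * x + real (Suc k) * pi / 2)" for x
    unfolding sin_expansion_lemma
    by (intro DERIV_imp_deriv) (auto intro!: derivative_eq_intros)
  then show ?case using Suc by auto
qed simp

lemma taylor_coeff_sin_scaled:
  "(deriv ^^ k) (\<lambda>x::real. sin (c * x)) 0 / fact k = sin_coeff k * c ^ k"
proof (cases "even k")
  case True
  then obtain m where "k = 2 * m" by blast
  then show ?thesis by (simp add: funpow_deriv_sin_scaled sin_coeff_def)
next
  case False
  then obtain m where k: "k = 2 * m + 1" by (rule oddE)
  have "sin (real k * pi / 2) = sin (real m * pi + pi / 2)" by (simp add: k field_simps)
  also have "\<dots> = (- 1) ^ m" by (simp add: sin_add)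
  finally have "sin (real k * pi / 2) = (- 1) ^ m" .
  moreover have "sin_coeff k = (- 1) ^ m / fact k" using k by (simp add: sin_coeff_def)
  ultimately show ?thesis by (simp add: funpow_deriv_sin_scaled)
qed

lemma funpow_deriv_sinh_scaled:
  "(deriv ^^ k) (\<lambda>x::real. sinh (c * x)) =
    (\<lambda>x. c ^ k * (if even k then sinh (c * x) else cosh (c * x)))"
proof (induction k)
  case (Suc k)
  have "deriv (\<lambda>x. c ^ k * (if even k then sinh (c * x) else cosh (c * x))) x
      = c ^ Suc k * (if even (Suc k) then sinh (c * x) else cosh (c * x))" for x
    by (cases "even k") (auto intro!: DERIV_imp_deriv derivative_eq_intros)
  then show ?case using Suc by auto
qed simp

lemma taylor_coeff_sinh_scaled:
  "(deriv ^^ k) (\<lambda>x::real. sinh (c * x)) 0 / fact k = (if even k then 0 else c ^ k / fact k)"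
  by (simp add: funpow_deriv_sinh_scaled)

text \<open>\<open>suminf\<close> is a total operator, so an equation for
  \<open>entire_apply\<close> by itself asserts no convergence. The \<open>sums\<close> form
  supplies it, so that values can be compared by uniqueness of limits.\<close>

lemma entire_apply_sin_sums:
  assumes "finite_dimensional_space TYPE('v::real_normed_vector)" "linear (A :: 'v \<Rightarrow> 'v)"
  shows "(\<lambda>k. (sin_coeff k * c ^ k) *\<^sub>R (A ^^ k) v) sums entire_apply (\<lambda>x. sin (c * x)) A v"
proof -
  have "summable (\<lambda>k. \<bar>sin_coeff k * c ^ k\<bar> * r ^ k)" if "r \<ge> 0" for r
    using summable_norm_sin[of "\<bar>c\<bar> * r"] that by (simp add: abs_mult power_mult_distrib power_abs mult_ac)
  then have "summable (\<lambda>k. (sin_coeff k * c ^ k) *\<^sub>R (A ^^ k) v)"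
    by (rule finite_dimensional_power_series_summable[OF assms])
  then show ?thesis
    unfolding entire_apply_def taylor_coeff_sin_scaled by (rule summable_sums)
qed

lemma entire_apply_sinh_sums:
  assumes "finite_dimensional_space TYPE('v::real_normed_vector)" "linear (A :: 'v \<Rightarrow> 'v)"
  shows "(\<lambda>k. (if even k then 0 else c ^ k / fact k) *\<^sub>R (A ^^ k) v)
    sums entire_apply (\<lambda>x. sinh (c * x)) A v"
proof -
  have "summable (\<lambda>k. \<bar>if even k then 0 else c ^ k / fact k\<bar> * r ^ k)" if "r \<ge> 0" for r
  proof (rule summable_comparison_test')
    show "summable (\<lambda>k. (\<bar>c\<bar> * r) ^ k /\<^sub>R fact k)" by (rule summable_exp_generic)
    show "norm (\<bar>if even k then 0 else c ^ k / fact k\<bar> * r ^ k) \<le> (\<bar>c\<bar> * r) ^ k /\<^sub>R fact k" for k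
      using that by (auto simp: power_mult_distrib power_abs abs_mult field_simps)
  qed
  then have "summable (\<lambda>k. (if even k then 0 else c ^ k / fact k) *\<^sub>R (A ^^ k) v)"
    by (rule finite_dimensional_power_series_summable[OF assms])
  then show ?thesis
    unfolding entire_apply_def taylor_coeff_sinh_scaled by (rule summable_sums)
qed

text \<open>Links the termwise differentiated series, in which the simplicity of zeros is phrased,
  to the derivative of a function known in closed form.\<close>

lemma power_series_deriv_sums:
  fixes c :: "nat \<Rightarrow> real"
  assumes "\<And>x. (\<lambda>k. c k * x ^ k) sums f x" "(f has_real_derivative d) (at x)"
  shows "(\<lambda>k. c k * (of_nat k * x ^ (k - 1))) sums d"
proof -
  have s: "summable (\<lambda>k. c k * y ^ k)" for y using assms(1) by (rule sums_summable)
  have "f = (\<lambda>x. \<Sum>k. c k * x ^ k)" using assms(1) sums_unique by (intro ext) fastforce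
  then have "(f has_real_derivative (\<Sum>k. diffs c k * x ^ k)) (at x)"
    using termdiffs_strong_converges_everywhere[OF s] by simp
  then have d: "d = (\<Sum>k. diffs c k * x ^ k)" using assms(2) DERIV_unique by blast
  have "summable (\<lambda>k. diffs c k * x ^ k)" using s by (intro termdiff_converges_all)
  then have "(\<lambda>k. of_nat k * c k * x ^ (k - Suc 0)) sums (\<Sum>k. diffs c k * x ^ k)"
    by (rule diffs_equiv)
  then show ?thesis by (simp add: d mult_ac)
qed

lemma sin_of_real_pi_mult_eq_0:
  "sin (of_real pi * z) = 0 \<longleftrightarrow> (\<exists>n::int. z = of_int n)" for z :: complex
proof -
  have "of_real pi * z = of_real (of_int n * pi) \<longleftrightarrow> z = of_int n" for n
    by (auto simp: mult.commute)
  then show ?thesis unfolding sin_eq_0 by simp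
qed

lemma cos_neq_0_if_sin_eq_0: "sin x = 0 \<Longrightarrow> cos x \<noteq> 0" for x :: real
  using sin_cos_squared_add[of x] by auto

text \<open>All complex zeros of \<open>sin (pi z)\<close> are integers, and they are simple because
  sine and cosine have no common zero; the diagonalizability criterion applies with \<open>U\<close>
  the whole space.\<close>

lemma sin_pi_annihilates_imp_span:
  fixes E :: "'v::real_normed_vector \<Rightarrow> 'v"
  assumes fd: "finite_dimensional_space TYPE('v)" and E: "linear E"
    and "entire_apply (\<lambda>x. sin (pi * x)) E = (\<lambda>v. 0)"
  shows "v \<in> span {u. \<exists>n::int. E u = of_int n *\<^sub>R u}"
proof -
  let ?c = "\<lambda>k. sin_coeff k * pi ^ k" and ?F = "\<lambda>z::complex. sin (of_real pi * z)"
  have "v \<in> span {u \<in> UNIV. \<exists>x::real. ?F (of_real x) = 0 \<and> E u = x *\<^sub>R u}"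
  proof (rule power_series_annihilates_imp_diagonalizable[OF fd E, where c = ?c])
    show "(\<lambda>k. ?c k *\<^sub>R z ^ k) sums ?F z" for z
      using sin_converges[of "of_real pi * z"] by (simp add: power_mult_distrib scaleR_conv_of_real mult_ac)
    show "Im z = 0" if "?F z = 0" for z
      using that by (auto simp: sin_of_real_pi_mult_eq_0)
    show "\<exists>d. d \<noteq> 0 \<and> (\<lambda>k. ?c k * (of_nat k * x ^ (k - 1))) sums d" if "?F (of_real x) = 0" for x
    proof (intro exI conjI)
      have "of_real (sin (pi * x)) = (0::complex)" using that by (simp flip: sin_of_real)
      then show "pi * cos (pi * x) \<noteq> 0" using cos_neq_0_if_sin_eq_0 by simp
      have "(\<lambda>k. ?c k * x ^ k) sums sin (pi * x)" for x
        using sin_converges[of "pi * x"] by (simp add: power_mult_distrib mult_ac)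
      then show "(\<lambda>k. ?c k * (of_nat k * x ^ (k - 1))) sums (pi * cos (pi * x))"
        by (rule power_series_deriv_sums) (auto intro!: derivative_eq_intros)
    qed
    show "(\<lambda>k. ?c k *\<^sub>R (E ^^ k) u) sums 0" for u
      using entire_apply_sin_sums[OF fd E, of pi u] assms(3) by simp
  qed auto
  also have "\<dots> \<subseteq> span {u. \<exists>n::int. E u = of_int n *\<^sub>R u}"
  proof (intro span_mono subsetI)
    fix u assume "u \<in> {u \<in> UNIV. \<exists>x::real. ?F (of_real x) = 0 \<and> E u = x *\<^sub>R u}"
    then obtain x and n :: int where "complex_of_real x = of_int n" "E u = x *\<^sub>R u"
      unfolding sin_of_real_pi_mult_eq_0 by blast
    moreover from this(1) have "x = of_int n" by (metis Re_complex_of_real of_real_of_int_eq)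
    ultimately show "u \<in> {u. \<exists>n::int. E u = of_int n *\<^sub>R u}" by blast
  qed
  finally show ?thesis .
qed

text \<open>
  The zeros of \<open>sinh (\<pi> z)\<close> are imaginary, so the criterion is applied to \<open>S = - T\<^sup>2\<close> instead: with
  \<open>F (w\<^sup>2) = - w sin (\<pi> w)\<close> one has \<open>F(S) = T sinh (\<pi> T)\<close>. The extra factor \<open>T\<close> loses information
  only on the kernel of \<open>T\<^sup>2\<close>, where \<open>sinh (\<pi> T) = \<pi> T\<close>.
\<close>

lemma sinh_pi_annihilates_imp_span:
  fixes T :: "'v::real_normed_vector \<Rightarrow> 'v"
  assumes fd: "finite_dimensional_space TYPE('v)" and T: "linear T"
    and "entire_apply (\<lambda>x. sinh (pi * x)) T = (\<lambda>v. 0)"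
    and U: "subspace U" "\<And>u. u \<in> U \<Longrightarrow> T u \<in> U" and "v \<in> U"
  shows "v \<in> span {u \<in> U. \<exists>m::nat. T (T u) = - ((real m)\<^sup>2 *\<^sub>R u) \<and> (m = 0 \<longrightarrow> T u = 0)}"
proof -
  define S where "S u = - T (T u)" for u
  \<comment> \<open>The coefficient of \<open>w ^ (2 * k)\<close> in \<open>- w sin (pi w)\<close>.
    The case \<open>k = 0\<close> is separate because \<open>2 * k - 1\<close> is truncated to
    \<open>0\<close> there and the general formula would give \<open>1\<close>.\<close>
  define c where "c k = (if k = 0 then 0 else (- 1) ^ k * pi ^ (2 * k - 1) / fact (2 * k - 1))" for k
  \<comment> \<open>The branch of the square root is immaterial, since \<open>w sin (pi w)\<close>
    is even in \<open>w\<close>.\<close>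
  define F where "F z = - csqrt z * sin (of_real pi * csqrt z)" for z
  have mono: "strict_mono (\<lambda>j::nat. 2 * j + 1)" by (simp add: strict_mono_def)
  have range: "odd n \<Longrightarrow> n \<in> range (\<lambda>j::nat. 2 * j + 1)" for n by (auto elim: oddE)
  have F_sums: "(\<lambda>k. c k *\<^sub>R (w\<^sup>2) ^ k) sums (- w * sin (of_real pi * w))" for w :: complex
  proof -
    have "(\<lambda>j. sin_coeff (2 * j + 1) *\<^sub>R (of_real pi * w) ^ (2 * j + 1)) sums sin (of_real pi * w)"
      using sin_converges[of "of_real pi * w"] range
      by (subst sums_mono_reindex[OF mono]) (auto simp: sin_coeff_def)
    then have "(\<lambda>j. - w * (sin_coeff (2 * j + 1) *\<^sub>R (of_real pi * w) ^ (2 * j + 1)))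
        sums (- w * sin (of_real pi * w))"
      by (rule sums_mult)
    also have "(\<lambda>j. - w * (sin_coeff (2 * j + 1) *\<^sub>R (of_real pi * w) ^ (2 * j + 1)))
        = (\<lambda>j. c (Suc j) *\<^sub>R (w\<^sup>2) ^ Suc j)"
      by (auto simp: c_def sin_coeff_def scaleR_conv_of_real power_mult_distrib power2_eq_square
          power_mult power_add mult_ac)
    finally show ?thesis using sums_Suc[of "\<lambda>k. c k *\<^sub>R (w\<^sup>2) ^ k"] by (simp add: c_def)
  qed
  have F: "(\<lambda>k. c k *\<^sub>R z ^ k) sums F z" for z
    using F_sums[of "csqrt z"] by (simp add: F_def)
  have F_zero: "\<exists>m::nat. z = of_real ((real m)\<^sup>2)" if "F z = 0" for z
  proof -
    have "\<exists>n::int. csqrt z = of_int n"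
      using that sin_of_real_pi_mult_eq_0[of "csqrt z"] by (auto simp: F_def intro: exI[of _ 0])
    then obtain n :: int where "csqrt z = of_int n" by blast
    then have "z = (of_int n)\<^sup>2" by (metis power2_csqrt)
    also have "\<dots> = of_real ((real (nat \<bar>n\<bar>))\<^sup>2)" by simp
    finally show ?thesis by blast
  qed
  have simple: "\<exists>d. d \<noteq> 0 \<and> (\<lambda>k. c k * (of_nat k * x ^ (k - 1))) sums d" if "F (of_real x) = 0" for x
  proof -
    from F_zero[OF that] obtain m :: nat where "complex_of_real x = of_real ((real m)\<^sup>2)" by blast
    then have x: "x = (real m)\<^sup>2" by (simp only: of_real_eq_iff)
    define f where "f x = (\<Sum>k. c k * x ^ k)" for x
    have s: "summable (\<lambda>k. c k * x ^ k)" for x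
      using sums_summable[OF sums_Re[OF F[of "of_real x"]]] by (simp flip: of_real_power)
    define d where "d = (\<Sum>k. diffs c k * x ^ k)"
    have "(f has_real_derivative d) (at x)"
      unfolding f_def d_def by (rule termdiffs_strong_converges_everywhere[OF s])
    then have sums_d: "(\<lambda>k. c k * (of_nat k * x ^ (k - 1))) sums d"
      using s by (intro power_series_deriv_sums[of c f]) (auto simp: f_def)
    have "d \<noteq> 0"
    proof (cases "m = 0")
      case True
      \<comment> \<open>At \<open>0\<close> the substitution \<open>x = w\<^sup>2\<close> has
        vanishing derivative and says nothing about \<open>d\<close>, so \<open>d\<close> is read
        off the series, where only \<open>k = 1\<close> survives.\<close>
      have "(\<lambda>k. c k * (of_nat k * x ^ (k - 1))) sums (\<Sum>k\<in>{1}. c k * (of_nat k * x ^ (k - 1)))"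
      proof (rule sums_finite)
        show "c k * (of_nat k * x ^ (k - 1)) = 0" if "k \<notin> {1}" for k
          using that x True by (cases "k = 0") (auto simp: power_0_left)
      qed simp
      then have "d = c 1" using sums_d sums_unique2 by fastforce
      then show ?thesis by (simp add: c_def)
    next
      case False
      have fw: "f (w\<^sup>2) = - w * sin (pi * w)" for w
      proof -
        have "(\<lambda>k. Re (c k *\<^sub>R ((of_real w)\<^sup>2) ^ k)) sums Re (- of_real w * sin (of_real pi * of_real w))"
          by (intro sums_Re F_sums)
        also have "Re (- of_real w * sin (of_real pi * of_real w)) = - w * sin (pi * w)"
          by (simp flip: of_real_mult sin_of_real)
        finally show ?thesis
          by (simp add: f_def sums_iff flip: of_real_power)
      qed
      \<comment> \<open>Differentiating \<open>f (w\<^sup>2) = - w sin (pi w)\<close> at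
        \<open>w = m\<close> in two ways expresses \<open>2 m d\<close> through
        \<open>cos (pi m)\<close>, which is not zero.\<close>
      have "((\<lambda>w. f (w\<^sup>2)) has_real_derivative d * (2 * real m)) (at (real m))"
        using \<open>(f has_real_derivative d) (at x)\<close> unfolding x
        by (intro DERIV_chain2[where f = f and g = "\<lambda>w. w\<^sup>2"]) (auto intro!: derivative_eq_intros)
      moreover have "((\<lambda>w. - w * sin (pi * w)) has_real_derivative
          - (sin (pi * real m) + real m * (pi * cos (pi * real m)))) (at (real m))"
        by (auto intro!: derivative_eq_intros)
      ultimately have "d * (2 * real m) = - (sin (pi * real m) + real m * (pi * cos (pi * real m)))"
        unfolding fw using DERIV_unique by blast
      moreover have "sin (pi * real m) = 0" by (simp add: mult.commute)
      moreover have "cos (pi * real m) \<noteq> 0" by (rule cos_neq_0_if_sin_eq_0) fact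
      ultimately show ?thesis using False by auto
    qed
    then show ?thesis using sums_d by blast
  qed
  have S_lin: "linear S"
    using T unfolding S_def by (intro linearI) (simp_all add: linear_add linear_cmul)
  have S_pow: "(S ^^ k) u = (- 1) ^ k *\<^sub>R (T ^^ (2 * k)) u" for k u
    using T by (induction k) (simp_all add: S_def linear_cmul linear_neg)
  have vanish: "(\<lambda>k. c k *\<^sub>R (S ^^ k) u) sums 0" for u
  proof -
    \<comment> \<open>The vanishing of \<open>sinh (pi T)\<close> is used at \<open>T u\<close>:
      this supplies the extra factor \<open>T\<close>, so that odd powers of \<open>T\<close> on
      \<open>T u\<close> become powers of \<open>S\<close> on \<open>u\<close>.\<close>
    have "(\<lambda>k. (if even k then 0 else pi ^ k / fact k) *\<^sub>R (T ^^ k) (T u)) sums 0"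
      using entire_apply_sinh_sums[OF fd T, of pi "T u"] assms(3) by simp
    then have "(\<lambda>j. (pi ^ (2 * j + 1) / fact (2 * j + 1)) *\<^sub>R (T ^^ (2 * j + 1)) (T u)) sums 0"
      using range by (subst (asm) sums_mono_reindex[OF mono, symmetric]) auto
    also have "(\<lambda>j. (pi ^ (2 * j + 1) / fact (2 * j + 1)) *\<^sub>R (T ^^ (2 * j + 1)) (T u))
        = (\<lambda>j. c (Suc j) *\<^sub>R (S ^^ Suc j) u)"
      unfolding S_pow by (auto simp: c_def funpow_swap1 simp flip: power_mult_distrib)
    finally show ?thesis using sums_Suc[of "\<lambda>k. c k *\<^sub>R (S ^^ k) u"] by (simp add: c_def)
  qed
  have "v \<in> span {u \<in> U. \<exists>x::real. F (of_real x) = 0 \<and> S u = x *\<^sub>R u}"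
  proof (rule power_series_annihilates_imp_diagonalizable[OF fd S_lin U(1) _ F _ simple vanish \<open>v \<in> U\<close>])
    show "S u \<in> U" if "u \<in> U" for u
      using that U by (simp add: S_def subspace_neg)
    show "Im z = 0" if "F z = 0" for z
      using F_zero[OF that] by auto
  qed
  also have "\<dots> \<subseteq> span {u \<in> U. \<exists>m::nat. T (T u) = - ((real m)\<^sup>2 *\<^sub>R u) \<and> (m = 0 \<longrightarrow> T u = 0)}"
  proof (intro span_mono subsetI)
    fix u assume "u \<in> {u \<in> U. \<exists>x::real. F (of_real x) = 0 \<and> S u = x *\<^sub>R u}"
    then obtain x where u: "u \<in> U" "F (of_real x) = 0" "S u = x *\<^sub>R u" by blast
    obtain m :: nat where "complex_of_real x = of_real ((real m)\<^sup>2)" using F_zero[OF u(2)] by blast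
    then have x: "x = (real m)\<^sup>2" by (simp only: of_real_eq_iff)
    have TT: "T (T u) = - ((real m)\<^sup>2 *\<^sub>R u)" using u(3) by (metis S_def x minus_minus)
    moreover have "T u = 0" if "m = 0"
    proof -
      let ?s = "\<lambda>k. if even k then 0 else pi ^ k / fact k"
      have s: "(\<lambda>k. ?s k * x ^ k) sums sinh (pi * x)" for x
      proof -
        have "(\<lambda>k. ?s k * x ^ k) = (\<lambda>k. if even k then 0 else (pi * x) ^ k /\<^sub>R fact k)"
          by (auto simp: power_mult_distrib field_simps)
        then show ?thesis using sinh_converges[of "pi * x"] by simp
      qed
      have "(sinh \<circ> (*) pi has_real_derivative pi) (at 0)"
        unfolding o_def by (auto intro!: derivative_eq_intros)
      then have "(\<lambda>k. ?s k * (of_nat k * 0 ^ (k - 1))) sums pi"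
        by (intro power_series_deriv_sums[of ?s]) (use s in \<open>simp_all add: o_def\<close>)
      then have "(\<lambda>k. ?s k *\<^sub>R (T ^^ k) u) sums (0 *\<^sub>R u + pi *\<^sub>R T u)"
        using T TT that s[of 0] by (intro linear_power_series_jordan[where x = 0]) simp_all
      moreover have "(\<lambda>k. ?s k *\<^sub>R (T ^^ k) u) sums 0"
        using entire_apply_sinh_sums[OF fd T, of pi u] assms(3) by simp
      ultimately show ?thesis using sums_unique2 by fastforce
    qed
    ultimately show "u \<in> {u \<in> U. \<exists>m::nat. T (T u) = - ((real m)\<^sup>2 *\<^sub>R u) \<and> (m = 0 \<longrightarrow> T u = 0)}"
      using u(1) by blast
  qed
  finally show ?thesis .
qed

text \<open>
  A real rendering of a joint eigenvector in the complexification: \<open>v - i w\<close> has eigenvalue \<open>n\<close> under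
  \<open>E\<close> and \<open>i m\<close> under \<open>T\<close>, that is, \<open>n = - (p + q)\<close> and \<open>m = q - p\<close> with \<open>p \<le> q\<close>.
\<close>

definition hodge_vector ::
    "('v::real_normed_vector \<Rightarrow> 'v) \<Rightarrow> ('v \<Rightarrow> 'v) \<Rightarrow> int \<Rightarrow> nat \<Rightarrow> 'v \<Rightarrow> 'v \<Rightarrow> bool" where
  "hodge_vector E T n m v w \<longleftrightarrow>
     E v = of_int n *\<^sub>R v \<and> E w = of_int n *\<^sub>R w \<and>
     T v = of_nat m *\<^sub>R w \<and> T w = - (of_nat m *\<^sub>R v)"

text \<open>Since \<open>T\<close> commutes with \<open>E\<close>, it preserves each eigenspace of
  \<open>E\<close>; running the criterion for \<open>sinh\<close> inside the eigenspace yields joint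
  eigenvectors at once.\<close>

lemma eigenspace_subset_span_hodge_vectors:
  fixes E T :: "'v::real_normed_vector \<Rightarrow> 'v"
  assumes fd: "finite_dimensional_space TYPE('v)" and lin: "linear E" "linear T"
    and comm: "\<And>v. E (T v) = T (E v)"
    and sinh: "entire_apply (\<lambda>x. sinh (pi * x)) T = (\<lambda>v. 0)"
    and "E v = of_int n *\<^sub>R v"
  shows "v \<in> span {v. \<exists>m w. hodge_vector E T n m v w}"
proof -
  define U where "U = {v. E v = of_int n *\<^sub>R v}"
  have U: "subspace U"
    using lin by (auto simp: U_def subspace_def linear_0 linear_add linear_cmul algebra_simps)
  have TU: "T u \<in> U" if "u \<in> U" for u
    using that lin by (simp add: U_def comm linear_cmul)
  have "v \<in> span {u \<in> U. \<exists>m::nat. T (T u) = - ((real m)\<^sup>2 *\<^sub>R u) \<and> (m = 0 \<longrightarrow> T u = 0)}"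
    using assms(6) by (intro sinh_pi_annihilates_imp_span[OF fd lin(2) sinh U TU]) (auto simp: U_def)
  also have "\<dots> \<subseteq> span {v. \<exists>m w. hodge_vector E T n m v w}"
  proof (intro span_mono subsetI)
    fix u assume "u \<in> {u \<in> U. \<exists>m::nat. T (T u) = - ((real m)\<^sup>2 *\<^sub>R u) \<and> (m = 0 \<longrightarrow> T u = 0)}"
    then obtain m :: nat where u: "u \<in> U" "T (T u) = - ((real m)\<^sup>2 *\<^sub>R u)" "m = 0 \<longrightarrow> T u = 0" by blast
    \<comment> \<open>For \<open>m = 0\<close> the convention \<open>1 / 0 = 0\<close> makes the
      partner \<open>0\<close>, in agreement with \<open>T u = 0\<close>.\<close>
    have "hodge_vector E T n m u ((1 / real m) *\<^sub>R T u)"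
      using u TU[OF u(1)] lin
      by (cases "m = 0") (simp_all add: hodge_vector_def U_def linear_cmul linear_0 power2_eq_square)
    then show "u \<in> {v. \<exists>m w. hodge_vector E T n m v w}" by blast
  qed
  finally show ?thesis .
qed

text \<open>The parity equation is deliberately kept out: for the generators of a Hodge structure it
  is itself deduced from this spanning statement.\<close>

lemma hodge_vectors_span:
  fixes E T :: "'v::real_normed_vector \<Rightarrow> 'v"
  assumes fd: "finite_dimensional_space TYPE('v)" and lin: "linear E" "linear T"
    and comm: "\<And>v. E (T v) = T (E v)"
    and sin: "entire_apply (\<lambda>x. sin (pi * x)) E = (\<lambda>v. 0)"
    and sinh: "entire_apply (\<lambda>x. sinh (pi * x)) T = (\<lambda>v. 0)"
  shows "span {v. \<exists>n m w. hodge_vector E T n m v w} = UNIV"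
proof -
  have "{u. \<exists>n::int. E u = of_int n *\<^sub>R u} \<subseteq> span {v. \<exists>n m w. hodge_vector E T n m v w}"
  proof
    fix u assume "u \<in> {u. \<exists>n::int. E u = of_int n *\<^sub>R u}"
    then obtain n :: int where "E u = of_int n *\<^sub>R u" by blast
    then have "u \<in> span {v. \<exists>m w. hodge_vector E T n m v w}"
      by (rule eigenspace_subset_span_hodge_vectors[OF fd lin comm sinh])
    then show "u \<in> span {v. \<exists>n m w. hodge_vector E T n m v w}"
      by (rule span_mono[THEN subsetD, rotated]) blast
  qed
  then have "span {u. \<exists>n::int. E u = of_int n *\<^sub>R u} \<subseteq> span {v. \<exists>n m w. hodge_vector E T n m v w}"
    by (rule span_minimal) simp
  then show ?thesis using sin_pi_annihilates_imp_span[OF fd lin(1) sin] by blast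
qed

section \<open>The parity condition\<close>

lemma entire_apply_sin_half_pi_hodge_vector:
  fixes E T :: "'v::real_normed_vector \<Rightarrow> 'v"
  assumes fd: "finite_dimensional_space TYPE('v)" and lin: "linear E" "linear T"
    and "hodge_vector E T n m v w"
  shows "entire_apply (\<lambda>x. sin (pi / 2 * x)) (\<lambda>v. (E ^^ 2) v + (T ^^ 2) v) v
    = sin (pi / 2 * of_int (n\<^sup>2 - (int m)\<^sup>2)) *\<^sub>R v"
proof -
  let ?A = "\<lambda>v. (E ^^ 2) v + (T ^^ 2) v" and ?x = "of_int (n\<^sup>2 - (int m)\<^sup>2) :: real"
  let ?c = "\<lambda>k. sin_coeff k * (pi / 2) ^ k"
  have A: "linear ?A" using lin by (intro linear_compose_add linear_funpow)
  have "?A v = ?x *\<^sub>R v"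
    using assms(4) lin
    by (simp add: hodge_vector_def numeral_2_eq_2 linear_cmul linear_neg algebra_simps)
  moreover have "(\<lambda>k. ?c k * ?x ^ k) sums sin (pi / 2 * ?x)"
    using sin_converges[of "pi / 2 * ?x"] by (simp add: power_mult_distrib power_divide mult_ac)
  ultimately have "(\<lambda>k. ?c k *\<^sub>R (?A ^^ k) v) sums (sin (pi / 2 * ?x) *\<^sub>R v)"
    by (rule linear_power_series_eigenvalue[OF A])
  then show ?thesis using entire_apply_sin_sums[OF fd A, of "pi / 2" v] sums_unique2 by blast
qed

lemma sin_half_pi_diff_squares_eq_0_iff:
  "sin (pi / 2 * of_int (n\<^sup>2 - (int m)\<^sup>2)) = 0 \<longleftrightarrow> even (n - int m)"
proof -
  have "sin (pi / 2 * of_int k) = 0 \<longleftrightarrow> even k" for k :: int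
  proof -
    have "pi / 2 * of_int k = of_int i * (pi / 2) \<longleftrightarrow> k = i" for i :: int by auto
    then show ?thesis unfolding sin_zero_iff_int by simp
  qed
  moreover have "even (n\<^sup>2 - (int m)\<^sup>2) \<longleftrightarrow> even (n - int m)" by simp
  ultimately show ?thesis by blast
qed


section \<open>The representation of a Hodge pair\<close>

text \<open>This is multiplication of the complex eigenvector \<open>v - i w\<close> by
  \<open>i\<close>. It makes every formula for the first vector of a pair available for the
  second.\<close>

lemma hodge_vector_rotate:
  assumes "linear E" "linear T" "hodge_vector E T n m v w"
  shows "hodge_vector E T n m w (- v)"
  using assms by (simp add: hodge_vector_def linear_neg)

text \<open>
  \<open>exp (ln |z| E + Arg z T)\<close>. The jump of \<^const>\<open>Arg\<close> is harmless because \<open>exp (2 \<pi> T) = 1\<close>.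
\<close>

definition hodge_rep ::
    "('v::real_normed_vector \<Rightarrow> 'v) \<Rightarrow> ('v \<Rightarrow> 'v) \<Rightarrow> complex \<Rightarrow> 'v \<Rightarrow> 'v" where
  "hodge_rep E T = restrict (\<lambda>z v. \<Sum>k. (1 / fact k) *\<^sub>R
     ((\<lambda>u. ln (cmod z) *\<^sub>R E u + Arg z *\<^sub>R T u) ^^ k) v) (- {0})"

lemma hodge_rep_linear:
  fixes E T :: "'v::real_normed_vector \<Rightarrow> 'v"
  assumes fd: "finite_dimensional_space TYPE('v)" and lin: "linear E" "linear T" and z: "z \<noteq> 0"
  shows "linear (hodge_rep E T z)"
proof -
  define A where "A u = ln (cmod z) *\<^sub>R E u + Arg z *\<^sub>R T u" for u
  have A: "linear A"
    unfolding A_def using lin by (intro linear_compose_add linear_compose_scale_right)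
  have "summable (\<lambda>k. \<bar>1 / fact k\<bar> * r ^ k)" for r :: real
    using summable_exp_generic[of r] by (simp add: field_simps)
  then have s: "summable (\<lambda>k. (1 / fact k) *\<^sub>R (A ^^ k) v)" for v
    by (intro finite_dimensional_power_series_summable[OF fd A]) auto
  have eq: "hodge_rep E T z v = (\<Sum>k. (1 / fact k) *\<^sub>R (A ^^ k) v)" for v
    using z by (simp add: hodge_rep_def A_def[abs_def])
  have pow: "linear (A ^^ k)" for k using A by (rule linear_funpow)
  show ?thesis
  proof (rule linearI)
    show "hodge_rep E T z (v + w) = hodge_rep E T z v + hodge_rep E T z w" for v w
      unfolding eq using suminf_add[OF s[of v] s[of w]]
      by (simp add: linear_add[OF pow] scaleR_add_right)
    show "hodge_rep E T z (c *\<^sub>R v) = c *\<^sub>R hodge_rep E T z v" for c v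
      unfolding eq using suminf_scaleR_right[OF s[of v], of c]
      by (simp add: linear_cmul[OF pow] mult.commute)
  qed
qed

text \<open>On the span of \<open>v\<close> and \<open>w\<close> the exponent is the complex number
  \<open>n ln |z| + i m Arg z\<close>, whose exponential is \<open>|z|^(n - m) z^m\<close>. In this
  form the branch of \<open>Arg\<close> has disappeared, which is what makes multiplicativity
  visible.\<close>

lemma hodge_rep_hodge_vector:
  fixes E T :: "'v::real_normed_vector \<Rightarrow> 'v"
  assumes lin: "linear E" "linear T" and "z \<noteq> 0" and vw: "hodge_vector E T n m v w"
  shows "hodge_rep E T z v = cmod z powi (n - int m) *\<^sub>R (Re (z ^ m) *\<^sub>R v + Im (z ^ m) *\<^sub>R w)"
proof -
  define r where "r = cmod z"
  define A where "A u = ln r *\<^sub>R E u + Arg z *\<^sub>R T u" for u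
  let ?x = "ln r * of_int n" and ?y = "Arg z * of_nat m"
  have r: "r > 0" using \<open>z \<noteq> 0\<close> by (simp add: r_def)
  have A: "linear A"
    unfolding A_def using lin by (intro linear_compose_add linear_compose_scale_right)
  have "A v = ?x *\<^sub>R v + ?y *\<^sub>R w" "A w = ?x *\<^sub>R w - ?y *\<^sub>R v"
    using vw by (simp_all add: A_def hodge_vector_def)
  then have "(\<lambda>k. (1 / fact k) *\<^sub>R (A ^^ k) v) sums
      (Re (exp (Complex ?x ?y)) *\<^sub>R v + Im (exp (Complex ?x ?y)) *\<^sub>R w)"
    using exp_converges[of "Complex ?x ?y"]
    by (intro linear_power_series_eigenvector[OF A]) (simp_all add: divide_inverse_commute)
  then have "hodge_rep E T z v = Re (exp (Complex ?x ?y)) *\<^sub>R v + Im (exp (Complex ?x ?y)) *\<^sub>R w"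
    using \<open>z \<noteq> 0\<close> by (simp add: hodge_rep_def sums_iff A_def[abs_def] r_def)
  moreover have "exp (Complex ?x ?y) = (r powi (n - int m)) *\<^sub>R z ^ m"
  proof -
    have "Complex ?x ?y = of_real (of_int n * ln r) + of_nat m * (\<i> * of_real (Arg z))"
      by (simp add: complex_eq_iff)
    then have "exp (Complex ?x ?y) = of_real (exp (of_int n * ln r)) * exp (\<i> * of_real (Arg z)) ^ m"
      by (simp only: exp_add exp_of_nat_mult exp_of_real)
    also have "exp (of_int n * ln r) = r powi n"
      using r by (simp flip: exp_power_int)
    also have "r powi n = r powi (n - int m) * r ^ m"
      using r by (simp flip: power_int_of_nat power_int_add)
    finally show ?thesis
      using Arg_eq[OF \<open>z \<noteq> 0\<close>, folded r_def]
      by (metis (no_types, lifting) mult.assoc of_real_mult of_real_power power_mult_distrib scaleR_conv_of_real)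
  qed
  ultimately show ?thesis by (simp add: r_def scaleR_add_right)
qed

text \<open>For odd \<open>n - m\<close> the third equation multiplies the vector by a nonzero sine,
  so the vector is zero and contributes nothing to the span.\<close>

lemma eigenspace_subset_span_hodge_vectors_even:
  fixes E T :: "'v::real_normed_vector \<Rightarrow> 'v"
  assumes fd: "finite_dimensional_space TYPE('v)" and pair: "hodge_pair E T"
    and "E v = of_int n *\<^sub>R v"
  shows "v \<in> span {v. \<exists>m w. hodge_vector E T n m v w \<and> even (n - int m)}"
proof -
  have lin: "linear E" "linear T" using pair by (auto simp: hodge_pair_def)
  have comm: "E (T v) = T (E v)" for v
    using pair by (auto simp: hodge_pair_def commutator_def dest: fun_cong[of _ _ v])
  have "{v. \<exists>m w. hodge_vector E T n m v w}
      \<subseteq> insert 0 {v. \<exists>m w. hodge_vector E T n m v w \<and> even (n - int m)}"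
  proof
    fix v assume "v \<in> {v. \<exists>m w. hodge_vector E T n m v w}"
    then obtain m w where vw: "hodge_vector E T n m v w" by blast
    have "sin (pi / 2 * of_int (n\<^sup>2 - (int m)\<^sup>2)) *\<^sub>R v = 0"
      using entire_apply_sin_half_pi_hodge_vector[OF fd lin vw] pair by (simp add: hodge_pair_def)
    then have "v = 0 \<or> even (n - int m)"
      using sin_half_pi_diff_squares_eq_0_iff unfolding scaleR_eq_0_iff by blast
    then show "v \<in> insert 0 {v. \<exists>m w. hodge_vector E T n m v w \<and> even (n - int m)}" using vw by blast
  qed
  then have "span {v. \<exists>m w. hodge_vector E T n m v w}
      \<subseteq> span (insert 0 {v. \<exists>m w. hodge_vector E T n m v w \<and> even (n - int m)})"
    by (rule span_mono)
  moreover have "v \<in> span {v. \<exists>m w. hodge_vector E T n m v w}"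
    using pair assms(3)
    by (intro eigenspace_subset_span_hodge_vectors[OF fd lin comm]) (auto simp: hodge_pair_def)
  ultimately show ?thesis by (auto simp: span_insert_0)
qed

lemma span_hodge_vectors_even:
  fixes E T :: "'v::real_normed_vector \<Rightarrow> 'v"
  assumes fd: "finite_dimensional_space TYPE('v)" and pair: "hodge_pair E T"
  shows "span {v. \<exists>n m w. hodge_vector E T n m v w \<and> even (n - int m)} = UNIV"
proof -
  have "{u. \<exists>n::int. E u = of_int n *\<^sub>R u} \<subseteq> span {v. \<exists>n m w. hodge_vector E T n m v w \<and> even (n - int m)}"
  proof
    fix u assume "u \<in> {u. \<exists>n::int. E u = of_int n *\<^sub>R u}"
    then obtain n :: int where "E u = of_int n *\<^sub>R u" by blast
    then have "u \<in> span {v. \<exists>m w. hodge_vector E T n m v w \<and> even (n - int m)}"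
      by (rule eigenspace_subset_span_hodge_vectors_even[OF fd pair])
    then show "u \<in> span {v. \<exists>n m w. hodge_vector E T n m v w \<and> even (n - int m)}"
      by (rule span_mono[THEN subsetD, rotated]) blast
  qed
  then have "span {u. \<exists>n::int. E u = of_int n *\<^sub>R u}
      \<subseteq> span {v. \<exists>n m w. hodge_vector E T n m v w \<and> even (n - int m)}"
    by (rule span_minimal) simp
  moreover have "v \<in> span {u. \<exists>n::int. E u = of_int n *\<^sub>R u}" for v
    using pair by (intro sin_pi_annihilates_imp_span[OF fd]) (auto simp: hodge_pair_def)
  ultimately show ?thesis by blast
qed

lemma real_polynomial_function_Re_Im_power:
  "real_polynomial_function (\<lambda>z. Re (z ^ m)) \<and> real_polynomial_function (\<lambda>z. Im (z ^ m))"
proof (induction m)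
  case (Suc m)
  have "real_polynomial_function Re" "real_polynomial_function Im"
    using bounded_linear_Re bounded_linear_Im by (auto intro: real_polynomial_function.intros(1))
  with Suc show ?case by auto
qed auto

lemma real_polynomial_function_cmod_power2:
  "real_polynomial_function (\<lambda>z. ((cmod z)\<^sup>2) ^ N)"
proof -
  have "real_polynomial_function Re" "real_polynomial_function Im"
    using bounded_linear_Re bounded_linear_Im by (auto intro: real_polynomial_function.intros(1))
  then show ?thesis unfolding cmod_power2 by (intro real_polynomial_function_power real_polynomial_function.intros(3))
qed

text \<open>Identities linear in the vector are checked on Hodge vectors, where the action is
  multiplication by \<open>|z|^(n - m) z^m\<close> and the group law is that of complex numbers.
  Matrix coefficients are handled by induction over linear combinations, bringing two fractions to a
  common denominator.\<close>

lemma hodge_rep_algebraic: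
  fixes E T :: "'v::real_normed_vector \<Rightarrow> 'v"
  assumes fd: "finite_dimensional_space TYPE('v)" and pair: "hodge_pair E T"
  shows "algebraic_rep (hodge_rep E T)"
proof -
  let ?\<rho> = "hodge_rep E T"
  let ?X = "{v. \<exists>n m w. hodge_vector E T n m v w \<and> even (n - int m)}"
  have lin: "linear E" "linear T" using pair by (auto simp: hodge_pair_def)
  have X: "v \<in> span ?X" for v using span_hodge_vectors_even[OF fd pair] by blast
  note \<rho>_lin = hodge_rep_linear[OF fd lin]
  note \<rho>_eq = hodge_rep_hodge_vector[OF lin]
  have "?\<rho> \<in> extensional (- {0})" unfolding hodge_rep_def by (rule restrict_extensional)
  moreover have "?\<rho> 1 = id"
  proof
    show "?\<rho> 1 v = id v" for v
    proof (rule linear_eq_on_span[where f = "?\<rho> 1" and g = id, OF _ _ _ X])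
      show "linear (?\<rho> 1)" "linear id" by (simp_all add: \<rho>_lin linear_id)
      show "?\<rho> 1 x = id x" if "x \<in> ?X" for x
        using that \<rho>_eq[of 1] by auto
    qed
  qed
  moreover have "?\<rho> (y * z) = ?\<rho> y \<circ> ?\<rho> z" if "y \<noteq> 0" "z \<noteq> 0" for y z
  proof
    show "?\<rho> (y * z) v = (?\<rho> y \<circ> ?\<rho> z) v" for v
    proof (rule linear_eq_on_span[where f = "?\<rho> (y * z)" and g = "?\<rho> y \<circ> ?\<rho> z", OF _ _ _ X])
      show "linear (?\<rho> (y * z))" "linear (?\<rho> y \<circ> ?\<rho> z)"
        using that by (auto intro: \<rho>_lin linear_compose)
      show "?\<rho> (y * z) v = (?\<rho> y \<circ> ?\<rho> z) v" if "v \<in> ?X" for v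
      proof -
        obtain n m w where vw: "hodge_vector E T n m v w" using \<open>v \<in> ?X\<close> by blast
        note wv = hodge_vector_rotate[OF lin vw]
        have "?\<rho> y (?\<rho> z v) = cmod z powi (n - int m) *\<^sub>R (Re (z ^ m) *\<^sub>R ?\<rho> y v + Im (z ^ m) *\<^sub>R ?\<rho> y w)"
          using \<open>y \<noteq> 0\<close> \<open>z \<noteq> 0\<close> by (simp add: \<rho>_eq[OF _ vw, of z] linear_cmul[OF \<rho>_lin] linear_add[OF \<rho>_lin])
        also have "\<dots> = (cmod y * cmod z) powi (n - int m) *\<^sub>R
            (Re (y ^ m * z ^ m) *\<^sub>R v + Im (y ^ m * z ^ m) *\<^sub>R w)"
          using \<open>y \<noteq> 0\<close> by (simp add: \<rho>_eq[OF _ vw, of y] \<rho>_eq[OF _ wv, of y] power_int_mult_distrib algebra_simps)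
        also have "\<dots> = ?\<rho> (y * z) v"
          using \<open>y \<noteq> 0\<close> \<open>z \<noteq> 0\<close> by (simp add: \<rho>_eq[OF _ vw] norm_mult power_mult_distrib)
        finally show ?thesis by simp
      qed
    qed
  qed
  moreover have "\<exists>(N::nat) (p::complex \<Rightarrow> 'v). polynomial_function p \<and>
      (\<forall>z. z \<noteq> 0 \<longrightarrow> ?\<rho> z v = (1 / ((cmod z)\<^sup>2) ^ N) *\<^sub>R p z)" for v
    using X[of v]
  proof (induction rule: span_induct_alt)
    case base
    show ?case using linear_0[OF \<rho>_lin] by (intro exI[of _ 0] exI[of _ "\<lambda>_. 0"]) auto
  next
    case (step r u v)
    obtain N p where v: "polynomial_function p"
      "\<And>z. z \<noteq> 0 \<Longrightarrow> ?\<rho> z v = (1 / ((cmod z)\<^sup>2) ^ N) *\<^sub>R p z"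
      using step.IH by blast
    obtain n m w where uw: "hodge_vector E T n m u w" "even (n - int m)" using step.hyps by blast
    define q where "q z = Re (z ^ m) *\<^sub>R u + Im (z ^ m) *\<^sub>R w" for z
    have q: "polynomial_function q"
      unfolding q_def using real_polynomial_function_Re_Im_power[of m]
      by (intro polynomial_function_add polynomial_function_mult) (auto simp: real_polynomial_function_eq)
    obtain j where "n - int m = 2 * j" using uw(2) by blast
    then have powi: "cmod z powi (n - int m) = ((cmod z)\<^sup>2) powi j" for z
      by (simp add: power_int_mult)
    \<comment> \<open>The factor \<open>|z|^(2 j)\<close> belongs in the numerator for
      \<open>j \<ge> 0\<close> and in the denominator otherwise; of \<open>nat j\<close> and
      \<open>M\<close> at least one is \<open>0\<close>. \<open>P\<close> is the numerator over the
      common denominator with exponent \<open>N + M\<close>.\<close>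
    define M where "M = nat (- j)"
    define P where "P z = r *\<^sub>R (((cmod z)\<^sup>2) ^ (N + nat j)) *\<^sub>R q z + (((cmod z)\<^sup>2) ^ M) *\<^sub>R p z" for z
    have "polynomial_function P"
      unfolding P_def using q v(1) real_polynomial_function_cmod_power2
      by (intro polynomial_function_add polynomial_function_cmul polynomial_function_mult)
        (auto simp: real_polynomial_function_eq)
    moreover have "?\<rho> z (r *\<^sub>R u + v) = (1 / ((cmod z)\<^sup>2) ^ (N + M)) *\<^sub>R P z" if "z \<noteq> 0" for z
    proof -
      have z: "(cmod z)\<^sup>2 \<noteq> 0" using that by simp
      have "(cmod z)\<^sup>2 powi j = ((cmod z)\<^sup>2) ^ nat j / ((cmod z)\<^sup>2) ^ M"
        using z by (cases "j \<ge> 0") (auto simp: power_int_def M_def field_simps)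
      then have "?\<rho> z (r *\<^sub>R u + v) = r *\<^sub>R (((cmod z)\<^sup>2) ^ nat j / ((cmod z)\<^sup>2) ^ M) *\<^sub>R q z
          + (1 / ((cmod z)\<^sup>2) ^ N) *\<^sub>R p z"
        using that by (simp add: linear_add[OF \<rho>_lin] linear_cmul[OF \<rho>_lin] v(2) \<rho>_eq[OF _ uw(1)] powi q_def)
      also have "\<dots> = (1 / ((cmod z)\<^sup>2) ^ (N + M)) *\<^sub>R P z"
        using z by (simp add: P_def power_add scaleR_add_right)
      finally show ?thesis .
    qed
    ultimately show ?case by blast
  qed
  ultimately show ?thesis unfolding algebraic_rep_def using \<rho>_lin by blast
qed

section \<open>Decomposition into weight spaces\<close>

text \<open>Applying \<open>E - c a\<close> kills the summand at \<open>a\<close> and multiplies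
  every other one by the nonzero number \<open>c i - c a\<close>, which leaves a shorter relation
  among eigenvectors.\<close>

lemma eigenvectors_sum_eq_0:
  fixes c :: "'i \<Rightarrow> real"
  assumes E: "linear E" and "finite I" "inj_on c I"
    and "\<And>i. i \<in> I \<Longrightarrow> E (w i) = c i *\<^sub>R w i" "(\<Sum>i\<in>I. w i) = 0" "i \<in> I"
  shows "w i = 0"
  using assms(2-)
proof (induction I arbitrary: w i rule: finite_induct)
  case (insert a I)
  have "E (\<Sum>i\<in>insert a I. w i) - c a *\<^sub>R (\<Sum>i\<in>insert a I. w i) = 0"
    using insert.prems(3) E by (simp add: linear_0)
  moreover have "E (\<Sum>i\<in>insert a I. w i) = (\<Sum>i\<in>insert a I. c i *\<^sub>R w i)"
    unfolding linear_sum[OF E] using insert.prems(2) by (intro sum.cong) auto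
  ultimately have "(\<Sum>i\<in>insert a I. (c i - c a) *\<^sub>R w i) = 0"
    by (simp only: scaleR_sum_right scaleR_diff_left sum_subtractf)
  then have sum: "(\<Sum>i\<in>I. (c i - c a) *\<^sub>R w i) = 0" using insert.hyps by simp
  have w: "w i = 0" if "i \<in> I" for i
  proof -
    have "(c i - c a) *\<^sub>R w i = 0"
    proof (rule insert.IH[OF _ _ sum that])
      show "inj_on c I" using insert.prems(1) by simp
      show "E ((c i - c a) *\<^sub>R w i) = c i *\<^sub>R (c i - c a) *\<^sub>R w i" if "i \<in> I" for i
        using insert.prems(2)[of i] that E by (simp add: linear_cmul)
    qed
    moreover have "c i \<noteq> c a" using insert.prems(1) insert.hyps(2) that by (auto simp: inj_on_def)
    ultimately show ?thesis by simp
  qed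
  then have "w a = 0" using insert.prems(3) insert.hyps by simp
  with w show ?case using insert.prems(4) by blast
qed simp

text \<open>A finite spanning set \<open>Y\<close> of eigenvectors involves finitely many
  eigenvalues, and \<open>N\<close> lists them without repetition: distinctness makes the sum
  direct, and the eigenvalues of \<open>Y\<close> suffice to exhaust the space.\<close>

lemma eigenspaces_internal_direct_sum:
  fixes E :: "'v::real_normed_vector \<Rightarrow> 'v"
  assumes fd: "finite_dimensional_space TYPE('v)" and E: "linear E"
    and "span {u. \<exists>n::int. E u = of_int n *\<^sub>R u} = UNIV"
  obtains k and N :: "nat \<Rightarrow> int" where "internal_direct_sum k (\<lambda>j. {u. E u = of_int (N j) *\<^sub>R u})"
proof -
  obtain Y where "Y \<subseteq> {u. \<exists>n::int. E u = of_int n *\<^sub>R u}" "finite Y" "independent Y"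
    "span Y = span {u. \<exists>n::int. E u = of_int n *\<^sub>R u}"
    by (rule finite_dimensional_finite_spanning_subset[OF fd])
  with assms(3) have Y: "Y \<subseteq> {u. \<exists>n::int. E u = of_int n *\<^sub>R u}" "finite Y" "span Y = UNIV"
    by simp_all
  then have "\<forall>y\<in>Y. \<exists>n::int. E y = of_int n *\<^sub>R y" by blast
  then obtain n :: "'v \<Rightarrow> int" where n: "\<And>y. y \<in> Y \<Longrightarrow> E y = of_int (n y) *\<^sub>R y" by metis
  define k where "k = card (n ` Y)"
  obtain N where N: "bij_betw N {..<k} (n ` Y)"
    using ex_bij_betw_nat_finite[of "n ` Y"] Y(2) by (auto simp: k_def atLeast0LessThan)
  define W where "W j = {u. E u = of_int (N j) *\<^sub>R u}" for j
  have W: "subspace (W j)" for j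
    using E by (auto simp: W_def subspace_def linear_0 linear_add linear_cmul algebra_simps)
  have "inj_on (\<lambda>w. \<Sum>j<k. w j) (Pi\<^sub>E {..<k} W)"
  proof (rule inj_onI)
    fix v w assume vw: "v \<in> Pi\<^sub>E {..<k} W" "w \<in> Pi\<^sub>E {..<k} W" "(\<Sum>j<k. v j) = (\<Sum>j<k. w j)"
    have "v j - w j = 0" if "j \<in> {..<k}" for j
    proof (rule eigenvectors_sum_eq_0[OF E, of "{..<k}" "\<lambda>j. of_int (N j)" "\<lambda>j. v j - w j"])
      show "inj_on (\<lambda>j. real_of_int (N j)) {..<k}"
        using N by (auto simp: bij_betw_def inj_on_def)
      show "E (v i - w i) = of_int (N i) *\<^sub>R (v i - w i)" if "i \<in> {..<k}" for i
        using PiE_mem[OF vw(1) that] PiE_mem[OF vw(2) that] E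
        by (simp add: W_def linear_diff scaleR_diff_right)
      show "(\<Sum>i<k. v i - w i) = 0" using vw(3) by (simp add: sum_subtractf)
    qed (use that in auto)
    then show "v = w" using vw(1,2) by (intro PiE_ext) auto
  qed
  moreover have "v \<in> (\<lambda>w. \<Sum>j<k. w j) ` Pi\<^sub>E {..<k} W" for v
  proof -
    have "v \<in> span Y" using Y(3) by simp
    then have "\<exists>w \<in> Pi\<^sub>E {..<k} W. (\<Sum>j<k. w j) = v"
    proof (induction rule: span_induct_alt)
      case base
      show ?case using W by (intro bexI[of _ "restrict (\<lambda>_. 0) {..<k}"]) (auto simp: subspace_0)
    next
      case (step r u v)
      then obtain w where w: "w \<in> Pi\<^sub>E {..<k} W" "(\<Sum>j<k. w j) = v" by blast
      have "n u \<in> N ` {..<k}" using N step.hyps by (auto simp: bij_betw_def)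
      then obtain j where j: "j < k" "N j = n u" by auto
      then have "u \<in> W j" using n step.hyps by (simp add: W_def)
      then have "restrict (\<lambda>i. (if i = j then r *\<^sub>R u else 0) + w i) {..<k} \<in> Pi\<^sub>E {..<k} W"
        using W w(1) by (auto intro!: subspace_add subspace_scale simp: subspace_0)
      moreover have "(\<Sum>i<k. restrict (\<lambda>i. (if i = j then r *\<^sub>R u else 0) + w i) {..<k} i) = r *\<^sub>R u + v"
        using j w(2) by (simp add: sum.distrib)
      ultimately show ?case by blast
    qed
    then show ?thesis by blast
  qed
  ultimately have "internal_direct_sum k W"
    unfolding internal_direct_sum_def bij_betw_def by blast
  then show ?thesis using that unfolding W_def by blast
qed

text \<open>The weight spaces are the eigenspaces of \<open>E\<close>. The weight is minus the
  eigenvalue, because a real scalar \<open>t\<close> acts in weight \<open>n\<close> by the power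
  \<open>- n\<close>.\<close>

lemma hodge_rep_hodge_structure:
  fixes E T :: "'v::real_normed_vector \<Rightarrow> 'v"
  assumes fd: "finite_dimensional_space TYPE('v)" and pair: "hodge_pair E T"
  shows "hodge_structure (hodge_rep E T)"
proof -
  have lin: "linear E" "linear T" using pair by (auto simp: hodge_pair_def)
  note \<rho>_lin = hodge_rep_linear[OF fd lin]
  note \<rho>_eq = hodge_rep_hodge_vector[OF lin]
  have "span {u. \<exists>n::int. E u = of_int n *\<^sub>R u} = UNIV"
    using sin_pi_annihilates_imp_span[OF fd lin(1)] pair by (auto simp: hodge_pair_def)
  then obtain k and N :: "nat \<Rightarrow> int" where
    kN: "internal_direct_sum k (\<lambda>j. {u. E u = of_int (N j) *\<^sub>R u})"
    using eigenspaces_internal_direct_sum[OF fd lin(1)] by blast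
  have "hodge_weight_on (- n) {u. E u = of_int n *\<^sub>R u} (hodge_rep E T)" for n
    unfolding hodge_weight_on_def
  proof (intro conjI allI impI ballI subsetI)
    show "subspace {u. E u = of_int n *\<^sub>R u}"
      using lin by (auto simp: subspace_def linear_0 linear_add linear_cmul algebra_simps)
  next
    fix z :: complex and y assume "z \<noteq> 0" and y: "y \<in> hodge_rep E T z ` {u. E u = of_int n *\<^sub>R u}"
    then obtain u where u: "E u = of_int n *\<^sub>R u" "y = hodge_rep E T z u" by blast
    have "(E \<circ> hodge_rep E T z) u = of_int n *\<^sub>R hodge_rep E T z u"
    proof (rule linear_eq_on_span[where f = "E \<circ> hodge_rep E T z" and g = "\<lambda>u. of_int n *\<^sub>R hodge_rep E T z u",
          OF _ _ _ eigenspace_subset_span_hodge_vectors_even[OF fd pair u(1)]])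
      show "linear (E \<circ> hodge_rep E T z)" using \<rho>_lin[OF \<open>z \<noteq> 0\<close>] lin(1) by (rule linear_compose)
      show "linear (\<lambda>u. of_int n *\<^sub>R hodge_rep E T z u)"
        using \<rho>_lin[OF \<open>z \<noteq> 0\<close>] by (rule linear_compose_scale_right)
      fix x assume "x \<in> {v. \<exists>m w. hodge_vector E T n m v w \<and> even (n - int m)}"
      then obtain m w where xw: "hodge_vector E T n m x w" by blast
      then show "(E \<circ> hodge_rep E T z) x = of_int n *\<^sub>R hodge_rep E T z x"
        using lin \<open>z \<noteq> 0\<close>
        by (simp add: \<rho>_eq[OF _ xw] linear_add linear_cmul hodge_vector_def scaleR_add_right mult_ac)
    qed
    then show "y \<in> {u. E u = of_int n *\<^sub>R u}" using u(2) by simp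
  next
    fix t :: real and u assume t: "t \<noteq> 0" and "u \<in> {u. E u = of_int n *\<^sub>R u}"
    then have u: "E u = of_int n *\<^sub>R u" by simp
    have t0: "complex_of_real t \<noteq> 0" using t by simp
    show "hodge_rep E T (of_real t) u = t powi (- (- n)) *\<^sub>R u"
    proof (rule linear_eq_on_span[where f = "hodge_rep E T (of_real t)" and g = "\<lambda>u. t powi (- (- n)) *\<^sub>R u",
          OF _ _ _ eigenspace_subset_span_hodge_vectors_even[OF fd pair u]])
      show "linear (hodge_rep E T (of_real t))" using \<rho>_lin[OF t0] .
      show "linear (\<lambda>u. t powi (- (- n)) *\<^sub>R u)" by (rule linear_scale_self)
      fix x assume "x \<in> {v. \<exists>m w. hodge_vector E T n m v w \<and> even (n - int m)}"
      then obtain m w where xw: "hodge_vector E T n m x w" "even (n - int m)" by blast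
      \<comment> \<open>For negative \<open>t\<close> the absolute value can only be dropped because
        the exponent is even; the remaining \<open>t ^ m\<close> then completes the power to
        \<open>t powi n\<close>.\<close>
      have "\<bar>t\<bar> powi (n - int m) = t powi (n - int m)"
        using xw(2) by (simp add: abs_if power_int_minus_left)
      moreover have "t powi (n - int m) * t ^ m = t powi n"
        using t by (simp flip: power_int_of_nat power_int_add)
      ultimately show "hodge_rep E T (of_real t) x = t powi (- (- n)) *\<^sub>R x"
        by (simp add: \<rho>_eq[OF t0 xw(1)] flip: of_real_power)
    qed
  qed
  then show ?thesis
    unfolding hodge_structure_def using hodge_rep_algebraic[OF fd pair] kN
    by (intro conjI exI[of _ k] exI[of _ "\<lambda>j. {u. E u = of_int (N j) *\<^sub>R u}"] exI[of _ "\<lambda>j. - N j"]) auto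
qed

text \<open>On a Hodge vector the positive reals act by \<open>exp (n s)\<close> and the unit circle
  rotates \<open>v\<close> towards \<open>w\<close> through the angle \<open>m \<theta>\<close>.
  Genuine derivatives are established at every vector, since \<open>vector_derivative\<close> is a
  choice operator.\<close>

lemma hodge_generators_hodge_rep:
  fixes E T :: "'v::real_normed_vector \<Rightarrow> 'v"
  assumes fd: "finite_dimensional_space TYPE('v)" and pair: "hodge_pair E T"
  shows "hodge_generators (hodge_rep E T) = (E, T)"
proof -
  let ?\<rho> = "hodge_rep E T"
  let ?X = "{v. \<exists>n m w. hodge_vector E T n m v w \<and> even (n - int m)}"
  have lin: "linear E" "linear T" using pair by (auto simp: hodge_pair_def)
  have X: "v \<in> span ?X" for v using span_hodge_vectors_even[OF fd pair] by blast
  note \<rho>_lin = hodge_rep_linear[OF fd lin]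
  note \<rho>_eq = hodge_rep_hodge_vector[OF lin]
  have E: "((\<lambda>s::real. ?\<rho> (exp (of_real s)) v) has_vector_derivative E v) (at 0)" for v
    using X[of v]
  proof (induction rule: span_induct_alt)
    case base
    then show ?case using linear_0[OF \<rho>_lin] lin by (simp add: linear_0)
  next
    case (step r u v)
    obtain n m w where uw: "hodge_vector E T n m u w" using step.hyps by blast
    have "?\<rho> (exp (of_real s)) u = exp (of_int n * s) *\<^sub>R u" for s
    proof -
      have "exp s powi (n - int m) * exp s ^ m = exp (of_int n * s)"
        by (simp add: exp_power_int algebra_simps flip: exp_add exp_of_nat_mult)
      then show ?thesis by (simp add: \<rho>_eq[OF _ uw] exp_of_real flip: of_real_power)
    qed
    moreover have "((\<lambda>s. exp (of_int n * s) *\<^sub>R u) has_vector_derivative E u) (at 0)"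
      using uw by (auto intro!: derivative_eq_intros simp: hodge_vector_def)
    ultimately have "((\<lambda>s::real. ?\<rho> (exp (of_real s)) u) has_vector_derivative E u) (at 0)" by simp
    then have "((\<lambda>s::real. r *\<^sub>R ?\<rho> (exp (of_real s)) u + ?\<rho> (exp (of_real s)) v)
        has_vector_derivative (r *\<^sub>R E u + E v)) (at 0)"
      using step.IH by (intro has_vector_derivative_add bounded_linear.has_vector_derivative[OF bounded_linear_scaleR_right])
    then show ?case using lin by (simp add: linear_add[OF \<rho>_lin] linear_cmul[OF \<rho>_lin] linear_add linear_cmul)
  qed
  have T: "((\<lambda>\<theta>::real. ?\<rho> (exp (\<i> * of_real \<theta>)) v) has_vector_derivative T v) (at 0)" for v
    using X[of v]
  proof (induction rule: span_induct_alt)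
    case base
    then show ?case using linear_0[OF \<rho>_lin] lin by (simp add: linear_0)
  next
    case (step r u v)
    obtain n m w where uw: "hodge_vector E T n m u w" using step.hyps by blast
    have "?\<rho> (exp (\<i> * of_real \<theta>)) u = cos (of_nat m * \<theta>) *\<^sub>R u + sin (of_nat m * \<theta>) *\<^sub>R w" for \<theta>
    proof -
      have "exp (\<i> * of_real \<theta>) ^ m = cis (of_nat m * \<theta>)"
        by (simp add: cis_conv_exp mult_ac flip: exp_of_nat_mult)
      then show ?thesis by (simp add: \<rho>_eq[OF _ uw])
    qed
    moreover have "((\<lambda>\<theta>. cos (of_nat m * \<theta>) *\<^sub>R u + sin (of_nat m * \<theta>) *\<^sub>R w)
        has_vector_derivative T u) (at 0)"
      using uw by (auto intro!: derivative_eq_intros simp: hodge_vector_def)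
    ultimately have "((\<lambda>\<theta>::real. ?\<rho> (exp (\<i> * of_real \<theta>)) u) has_vector_derivative T u) (at 0)" by simp
    then have "((\<lambda>\<theta>::real. r *\<^sub>R ?\<rho> (exp (\<i> * of_real \<theta>)) u + ?\<rho> (exp (\<i> * of_real \<theta>)) v)
        has_vector_derivative (r *\<^sub>R T u + T v)) (at 0)"
      using step.IH by (intro has_vector_derivative_add bounded_linear.has_vector_derivative[OF bounded_linear_scaleR_right])
    then show ?case using lin by (simp add: linear_add[OF \<rho>_lin] linear_cmul[OF \<rho>_lin] linear_add linear_cmul)
  qed
  show ?thesis
    unfolding hodge_generators_def using vector_derivative_at[OF E] vector_derivative_at[OF T] by auto
qed


section \<open>The generators of a Hodge structure\<close>

lemma one_parameter_group_linear_generator: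
  fixes g :: "real \<Rightarrow> 'v::real_normed_vector \<Rightarrow> 'v"
  assumes lin: "\<And>s. linear (g s)"
    and deriv: "\<And>v. ((\<lambda>s. g s v) has_vector_derivative A v) (at 0)"
  shows "linear A"
proof (rule linearI)
  show "A (v + w) = A v + A w" for v w
  proof (rule vector_derivative_unique_at[OF deriv])
    show "((\<lambda>s. g s (v + w)) has_vector_derivative A v + A w) (at 0)"
      using has_vector_derivative_add[OF deriv[of v] deriv[of w]] by (simp add: linear_add[OF lin])
  qed
  show "A (c *\<^sub>R v) = c *\<^sub>R A v" for c v
  proof (rule vector_derivative_unique_at[OF deriv])
    show "((\<lambda>s. g s (c *\<^sub>R v)) has_vector_derivative c *\<^sub>R A v) (at 0)"
      using bounded_linear.has_vector_derivative[OF bounded_linear_scaleR_right deriv[of v], of c]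
      by (simp add: linear_cmul[OF lin])
  qed
qed

text \<open>Taylor's formula is applied to the real functions sending \<open>t\<close> to
  \<open>\<phi> (g t v)\<close>, whose \<open>k\<close>-th derivative is
  \<open>\<phi> ((A ^^ k) (g t v))\<close>. The orbit is bounded on a compact interval and
  \<open>A\<close> is bounded, so the Lagrange remainder is dominated by a term of an exponential
  series.\<close>

lemma one_parameter_group_exp_series:
  fixes g :: "real \<Rightarrow> 'v::real_normed_vector \<Rightarrow> 'v"
  assumes fd: "finite_dimensional_space TYPE('v)"
    and lin: "\<And>s. linear (g s)"
    and g0: "\<And>v. g 0 v = v" and g_add: "\<And>s t v. g (s + t) v = g s (g t v)"
    and deriv: "\<And>v. ((\<lambda>s. g s v) has_vector_derivative A v) (at 0)"
  shows "(\<lambda>k. (s ^ k / fact k) *\<^sub>R (A ^^ k) v) sums g s v"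
proof (rule finite_dimensional_sums[OF fd])
  fix \<phi> :: "'v \<Rightarrow> real" assume \<phi>: "bounded_linear \<phi>"
  interpret \<phi>: bounded_linear \<phi> by (rule \<phi>)
  have A: "linear A" using lin deriv by (rule one_parameter_group_linear_generator)
  obtain K where K: "K \<ge> 0" "\<And>k v. norm ((A ^^ k) v) \<le> K ^ k * norm v"
    using finite_dimensional_funpow_bound[OF fd A] by blast
  obtain L where L: "L \<ge> 0" "\<And>v. norm (\<phi> v) \<le> norm v * L" using \<phi>.nonneg_bounded by blast
  \<comment> \<open>The group law \<open>g s = g (s - t) \<circ> g t\<close> carries the derivative
    at \<open>0\<close> over to \<open>t\<close>.\<close>
  have deriv_at: "((\<lambda>s. g s v) has_vector_derivative A (g t v)) (at t)" for t
  proof -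
    have "((\<lambda>s. s - t) has_vector_derivative 1) (at t)" by (auto intro!: derivative_eq_intros)
    moreover have "((\<lambda>s. g s (g t v)) has_vector_derivative A (g t v)) (at (t - t))"
      using deriv by simp
    ultimately have "((\<lambda>s. g s (g t v)) \<circ> (\<lambda>s. s - t) has_vector_derivative 1 *\<^sub>R A (g t v)) (at t)"
      by (rule vector_diff_chain_at)
    then show ?thesis by (simp add: o_def flip: g_add)
  qed
  have "continuous_on {- \<bar>s\<bar>..\<bar>s\<bar>} (\<lambda>t. g t v)"
    using deriv_at has_vector_derivative_continuous
    by (intro continuous_at_imp_continuous_on) blast
  then have "bounded ((\<lambda>t. g t v) ` {- \<bar>s\<bar>..\<bar>s\<bar>})"
    by (intro compact_imp_bounded compact_continuous_image) auto
  then obtain M where "\<forall>t\<in>{- \<bar>s\<bar>..\<bar>s\<bar>}. norm (g t v) \<le> M"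
    unfolding bounded_iff by auto
  then have M: "norm (g t v) \<le> M" if "\<bar>t\<bar> \<le> \<bar>s\<bar>" for t
    using that by (simp add: abs_le_iff)
  have "M \<ge> 0" using M[of 0] norm_ge_zero[of "g 0 v"] by linarith
  define D where "D k t = \<phi> ((A ^^ k) (g t v))" for k t
  have D: "DERIV (D k) t :> D (Suc k) t" for k t
  proof -
    have "bounded_linear (A ^^ k)"
      using finite_dimensional_linear_bounded[OF fd linear_funpow[OF A]] .
    then have "((\<lambda>t. \<phi> ((A ^^ k) (g t v))) has_vector_derivative \<phi> ((A ^^ k) (A (g t v)))) (at t)"
      by (intro \<phi>.has_vector_derivative bounded_linear.has_vector_derivative[of "A ^^ k"] deriv_at)
    then show ?thesis
      by (simp add: D_def[abs_def] has_real_derivative_iff_has_vector_derivative funpow_swap1)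
  qed
  have bound: "norm ((\<Sum>k<n. \<phi> ((s ^ k / fact k) *\<^sub>R (A ^^ k) v)) - \<phi> (g s v))
      \<le> L * M * ((K * \<bar>s\<bar>) ^ n /\<^sub>R fact n)" for n
  proof -
    obtain t where t: "\<bar>t\<bar> \<le> \<bar>s\<bar>"
      "D 0 s = (\<Sum>k<n. (D k 0 / fact k) * s ^ k) + (D n t / fact n) * s ^ n"
      using Maclaurin_all_le[of D "D 0" s n] D by blast
    have "norm (D n t) \<le> norm ((A ^^ n) (g t v)) * L" unfolding D_def by (rule L(2))
    also have "\<dots> \<le> (K ^ n * norm (g t v)) * L" using K L(1) by (intro mult_right_mono) auto
    also have "\<dots> \<le> (K ^ n * M) * L"
      using K L(1) M[OF t(1)] by (intro mult_right_mono mult_left_mono) auto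
    finally have D_bound: "norm (D n t) \<le> (K ^ n * M) * L" .
    have "(\<Sum>k<n. \<phi> ((s ^ k / fact k) *\<^sub>R (A ^^ k) v)) - \<phi> (g s v) = - (D n t / fact n) * s ^ n"
      using t(2) by (simp add: D_def g0 \<phi>.scaleR mult.commute)
    then have "norm ((\<Sum>k<n. \<phi> ((s ^ k / fact k) *\<^sub>R (A ^^ k) v)) - \<phi> (g s v))
        = norm (D n t) * (\<bar>s\<bar> ^ n / fact n)"
      by (simp add: abs_mult power_abs)
    also have "\<dots> \<le> (K ^ n * M) * L * (\<bar>s\<bar> ^ n / fact n)"
      using D_bound by (rule mult_right_mono) simp
    finally have "norm ((\<Sum>k<n. \<phi> ((s ^ k / fact k) *\<^sub>R (A ^^ k) v)) - \<phi> (g s v))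
        \<le> (K ^ n * M) * L * (\<bar>s\<bar> ^ n / fact n)" .
    then show ?thesis by (simp add: power_mult_distrib divide_inverse mult_ac)
  qed
  have "(\<lambda>n. (K * \<bar>s\<bar>) ^ n /\<^sub>R fact n) \<longlonglongrightarrow> 0"
    by (rule summable_LIMSEQ_zero[OF summable_exp_generic])
  then have "(\<lambda>n. L * M * ((K * \<bar>s\<bar>) ^ n /\<^sub>R fact n)) \<longlonglongrightarrow> 0"
    by (rule tendsto_mult_right_zero)
  then have "(\<lambda>n. (\<Sum>k<n. \<phi> ((s ^ k / fact k) *\<^sub>R (A ^^ k) v)) - \<phi> (g s v)) \<longlonglongrightarrow> 0"
    by (rule Lim_null_comparison[OF always_eventually[OF allI[OF bound]]])
  then show "(\<lambda>k. \<phi> ((s ^ k / fact k) *\<^sub>R (A ^^ k) v)) sums \<phi> (g s v)"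
    unfolding sums_def by (rule LIM_zero_cancel)
qed

section \<open>The differential of an algebraic representation\<close>

text \<open>A polynomial divided by a power of \<open>|z|^2\<close> is differentiable away from
  \<open>0\<close>. This is where algebraicity guarantees that the derivatives chosen in
  \<open>hodge_generators\<close> exist.\<close>

lemma algebraic_rep_differentiable_along:
  fixes \<rho> :: "complex \<Rightarrow> 'v::real_normed_vector \<Rightarrow> 'v" and \<gamma> :: "real \<Rightarrow> complex"
  assumes fd: "finite_dimensional_space TYPE('v)" and "algebraic_rep \<rho>"
    and "\<gamma> differentiable (at s)" "\<And>t. \<gamma> t \<noteq> 0"
  shows "(\<lambda>t. \<rho> (\<gamma> t) v) differentiable (at s)"
proof -
  obtain N and p :: "complex \<Rightarrow> 'v" where p: "polynomial_function p"
    "\<And>z. z \<noteq> 0 \<Longrightarrow> \<rho> z v = (1 / ((cmod z)\<^sup>2) ^ N) *\<^sub>R p z"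
    using assms(2) unfolding algebraic_rep_def by meson
  obtain B :: "'v set" and \<phi> where B: "finite B" "\<And>b. bounded_linear (\<phi> b)"
    "\<And>x. x = (\<Sum>b\<in>B. \<phi> b x *\<^sub>R b)"
    using finite_dimensional_coordinates[OF fd] by blast
  have "real_polynomial_function (\<lambda>z. \<phi> b (p z))" for b
    using p(1) B(2)[of b] by (auto simp: polynomial_function_def o_def)
  then have "(\<lambda>z. \<phi> b (p z) *\<^sub>R b) differentiable (at z)" for b z
    by (intro differentiable_scaleR differentiable_at_real_polynomial_function) auto
  then have "(\<lambda>z. \<Sum>b\<in>B. \<phi> b (p z) *\<^sub>R b) differentiable (at z)" for z
    using B(1) by (intro differentiable_sum) auto
  then have "p differentiable (at z)" for z by (simp flip: B(3))
  moreover have "(\<lambda>z. 1 / ((cmod z)\<^sup>2) ^ N) differentiable (at z)" if "z \<noteq> 0" for z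
    using that real_polynomial_function_cmod_power2
    by (intro differentiable_divide differentiable_at_real_polynomial_function) auto
  ultimately have "(\<lambda>z. (1 / ((cmod z)\<^sup>2) ^ N) *\<^sub>R p z) differentiable (at (\<gamma> s))"
    using assms(4) by (intro differentiable_scaleR) auto
  then have "(\<lambda>z. (1 / ((cmod z)\<^sup>2) ^ N) *\<^sub>R p z) \<circ> \<gamma> differentiable (at s)"
    using assms(3) by (intro differentiable_chain_at)
  then show ?thesis using p(2) assms(4) by (simp add: o_def)
qed

lemma algebraic_rep_generators:
  fixes \<rho> :: "complex \<Rightarrow> 'v::real_normed_vector \<Rightarrow> 'v"
  assumes fd: "finite_dimensional_space TYPE('v)" and rep: "algebraic_rep \<rho>"
    and gen: "hodge_generators \<rho> = (E, T)"
  shows "((\<lambda>s. \<rho> (exp (of_real s)) v) has_vector_derivative E v) (at 0)"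
    and "((\<lambda>\<theta>. \<rho> (exp (\<i> * of_real \<theta>)) v) has_vector_derivative T v) (at 0)"
    and "linear E" and "linear T"
    and "(\<lambda>k. (s ^ k / fact k) *\<^sub>R (E ^^ k) v) sums \<rho> (exp (of_real s)) v"
    and "(\<lambda>k. (\<theta> ^ k / fact k) *\<^sub>R (T ^^ k) v) sums \<rho> (exp (\<i> * of_real \<theta>)) v"
proof -
  have "E = (\<lambda>v. vector_derivative (\<lambda>s::real. \<rho> (exp (of_real s)) v) (at 0))"
    "T = (\<lambda>v. vector_derivative (\<lambda>\<theta>::real. \<rho> (exp (\<i> * of_real \<theta>)) v) (at 0))"
    using gen by (auto simp: hodge_generators_def)
  moreover have "(\<lambda>s. exp (c * complex_of_real s)) differentiable (at 0)" for c
  proof (rule differentiableI_vector, rule has_vector_derivative_real_field)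
    show "((\<lambda>z. exp (c * z)) has_field_derivative c) (at (of_real 0))"
      by (auto intro!: derivative_eq_intros)
  qed
  from this[of 1] this[of \<i>] have "(\<lambda>s. exp (complex_of_real s)) differentiable (at 0)"
    "(\<lambda>\<theta>. exp (\<i> * complex_of_real \<theta>)) differentiable (at 0)"
    by simp_all
  ultimately show
    E: "((\<lambda>s. \<rho> (exp (of_real s)) v) has_vector_derivative E v) (at 0)" and
    T: "((\<lambda>\<theta>. \<rho> (exp (\<i> * of_real \<theta>)) v) has_vector_derivative T v) (at 0)" for v
    using algebraic_rep_differentiable_along[OF fd rep]
    by (auto simp flip: vector_derivative_works)
  have lin: "linear (\<rho> (exp z))" for z using rep by (simp add: algebraic_rep_def)
  have one: "\<rho> 1 v = v" for v using rep by (simp add: algebraic_rep_def)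
  have mult: "\<rho> (exp y * exp z) v = \<rho> (exp y) (\<rho> (exp z) v)" for y z v
    using rep by (simp add: algebraic_rep_def)
  show "linear E" "linear T"
    by (rule one_parameter_group_linear_generator[OF lin E], rule one_parameter_group_linear_generator[OF lin T])
  show "(\<lambda>k. (s ^ k / fact k) *\<^sub>R (E ^^ k) v) sums \<rho> (exp (of_real s)) v"
    by (rule one_parameter_group_exp_series[where g = "\<lambda>s. \<rho> (exp (of_real s))", OF fd lin _ _ E])
      (simp_all add: one mult exp_add)
  show "(\<lambda>k. (\<theta> ^ k / fact k) *\<^sub>R (T ^^ k) v) sums \<rho> (exp (\<i> * of_real \<theta>)) v"
    by (rule one_parameter_group_exp_series[where g = "\<lambda>\<theta>. \<rho> (exp (\<i> * of_real \<theta>))", OF fd lin _ _ T])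
      (simp_all add: one mult exp_add distrib_left)
qed

text \<open>Polar decomposition writes a nonzero \<open>z\<close> as a product of points on the two
  one-parameter subgroups, each of which acts by the exponential series of its generator. The value
  at \<open>0\<close> is fixed by extensionality.\<close>

lemma algebraic_rep_eq_if_generators_eq:
  fixes \<rho> \<rho>' :: "complex \<Rightarrow> 'v::real_normed_vector \<Rightarrow> 'v"
  assumes fd: "finite_dimensional_space TYPE('v)" and rep: "algebraic_rep \<rho>" "algebraic_rep \<rho>'"
    and gen: "hodge_generators \<rho> = hodge_generators \<rho>'"
  shows "\<rho> = \<rho>'"
proof
  obtain E T where ET: "hodge_generators \<rho> = (E, T)" by fastforce
  then have ET': "hodge_generators \<rho>' = (E, T)" using gen by simp
  note series = algebraic_rep_generators(5,6)[OF fd rep(1) ET]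
  note series' = algebraic_rep_generators(5,6)[OF fd rep(2) ET']
  fix z
  show "\<rho> z = \<rho>' z"
  proof (cases "z = 0")
    case True
    then show ?thesis using rep by (auto simp: algebraic_rep_def extensional_def)
  next
    case False
    then have z: "z = exp (of_real (ln (cmod z))) * exp (\<i> * of_real (Arg z))"
      using Arg_eq[of z] by (simp add: exp_of_real)
    have "\<rho> (exp x * exp y) v = \<rho> (exp x) (\<rho> (exp y) v)"
      "\<rho>' (exp x * exp y) v = \<rho>' (exp x) (\<rho>' (exp y) v)" for x y v
      using rep by (simp_all add: algebraic_rep_def)
    moreover have "\<rho> (exp (of_real s)) v = \<rho>' (exp (of_real s)) v" for s v
      using series(1) series'(1) by (rule sums_unique2)
    moreover have "\<rho> (exp (\<i> * of_real s)) v = \<rho>' (exp (\<i> * of_real s)) v" for s v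
      using series(2) series'(2) by (rule sums_unique2)
    ultimately show ?thesis by (subst (1 2) z) (auto simp del: exp_of_real)
  qed
qed

lemma internal_direct_sum_span:
  assumes "internal_direct_sum k W"
  shows "span {u. \<exists>j<k. u \<in> W j} = UNIV"
proof -
  have "v \<in> span {u. \<exists>j<k. u \<in> W j}" for v
  proof -
    have "v \<in> (\<lambda>w. \<Sum>j<k. w j) ` Pi\<^sub>E {..<k} W"
      using assms by (auto simp: internal_direct_sum_def bij_betw_def)
    then obtain w where w: "w \<in> Pi\<^sub>E {..<k} W" "v = (\<Sum>j<k. w j)" by blast
    have "w j \<in> span {u. \<exists>j<k. u \<in> W j}" if "j \<in> {..<k}" for j
      using PiE_mem[OF w(1) that] that by (intro span_base) auto
    then show ?thesis unfolding w(2) by (intro span_sum)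
  qed
  then show ?thesis by blast
qed

text \<open>On \<open>W j\<close> the positive reals act by a power, so \<open>E\<close> is the
  scalar \<open>- n j\<close> there. Stability of \<open>W j\<close> then makes \<open>E\<close>
  commute with every \<open>\<rho> z\<close>, and differentiating along the unit circle gives
  commutation with \<open>T\<close>.\<close>

lemma hodge_generators_hodge_pair:
  fixes \<rho> :: "complex \<Rightarrow> 'v::real_normed_vector \<Rightarrow> 'v"
  assumes fd: "finite_dimensional_space TYPE('v)" and "hodge_structure \<rho>"
    and gen: "hodge_generators \<rho> = (E, T)"
  shows "hodge_pair E T"
proof -
  obtain k and W :: "nat \<Rightarrow> 'v set" and n :: "nat \<Rightarrow> int" where
    rep: "algebraic_rep \<rho>" and "internal_direct_sum k W"
    and W: "\<And>j. j < k \<Longrightarrow> hodge_weight_on (n j) (W j) \<rho>"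
    using assms(2) unfolding hodge_structure_def by blast
  note E_deriv = algebraic_rep_generators(1)[OF fd rep gen]
  note T_deriv = algebraic_rep_generators(2)[OF fd rep gen]
  note lin = algebraic_rep_generators(3,4)[OF fd rep gen]
  note T_series = algebraic_rep_generators(6)[OF fd rep gen]
  define X where "X = {u. \<exists>j<k. u \<in> W j}"
  have X: "v \<in> span X" for v
    unfolding X_def using internal_direct_sum_span[OF \<open>internal_direct_sum k W\<close>] by blast
  have \<rho>_lin: "linear (\<rho> z)" if "z \<noteq> 0" for z using rep that by (simp add: algebraic_rep_def)
  have weight: "\<rho> (of_real t) u = t powi (- n j) *\<^sub>R u" if "t \<noteq> 0" "j < k" "u \<in> W j" for t u j
    using W[OF that(2)] that(1,3) by (simp add: hodge_weight_on_def)
  have E_W: "E u = of_int (- n j) *\<^sub>R u" if "j < k" "u \<in> W j" for j u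
  proof (rule vector_derivative_unique_at[OF E_deriv])
    have "\<rho> (exp (of_real s)) u = exp (of_int (- n j) * s) *\<^sub>R u" for s
      using weight[of "exp s"] that by (simp add: exp_of_real exp_power_int)
    moreover have "((\<lambda>s. exp (of_int (- n j) * s) *\<^sub>R u) has_vector_derivative of_int (- n j) *\<^sub>R u) (at 0)"
      by (auto intro!: derivative_eq_intros)
    ultimately show "((\<lambda>s. \<rho> (exp (of_real s)) u) has_vector_derivative of_int (- n j) *\<^sub>R u) (at 0)"
      by simp
  qed
  have E_\<rho>: "E (\<rho> z v) = \<rho> z (E v)" if "z \<noteq> 0" for z v
  proof -
    have "(E \<circ> \<rho> z) v = (\<rho> z \<circ> E) v"
    proof (rule linear_eq_on_span[where f = "E \<circ> \<rho> z" and g = "\<rho> z \<circ> E", OF _ _ _ X])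
      show "linear (E \<circ> \<rho> z)" "linear (\<rho> z \<circ> E)"
        using lin(1) \<rho>_lin[OF that] by (auto intro: linear_compose)
      fix u assume "u \<in> X"
      then obtain j where j: "j < k" "u \<in> W j" by (auto simp: X_def)
      then have "\<rho> z u \<in> W j" using W[OF j(1)] that by (auto simp: hodge_weight_on_def)
      then show "(E \<circ> \<rho> z) u = (\<rho> z \<circ> E) u"
        using E_W[OF j] E_W[OF j(1)] \<rho>_lin[OF that] by (simp add: linear_cmul linear_neg)
    qed
    then show ?thesis by simp
  qed
  have comm: "E (T v) = T (E v)" for v
  proof (rule vector_derivative_unique_at)
    have "bounded_linear E" by (rule finite_dimensional_linear_bounded[OF fd lin(1)])
    then show "((\<lambda>\<theta>. E (\<rho> (exp (\<i> * of_real \<theta>)) v)) has_vector_derivative E (T v)) (at 0)"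
      by (rule bounded_linear.has_vector_derivative[OF _ T_deriv])
    show "((\<lambda>\<theta>. E (\<rho> (exp (\<i> * of_real \<theta>)) v)) has_vector_derivative T (E v)) (at 0)"
      using T_deriv[of "E v"] by (simp add: E_\<rho>)
  qed
  have sin_series: "(\<lambda>k. (sin_coeff k * pi ^ k) * x ^ k) sums sin (pi * x)" for x
    using sin_converges[of "pi * x"] by (simp add: power_mult_distrib mult_ac)
  have cos_series: "(\<lambda>k. (cos_coeff k * pi ^ k) * x ^ k) sums cos (pi * x)" for x
    using cos_converges[of "pi * x"] by (simp add: power_mult_distrib mult_ac)
  have sin_E: "entire_apply (\<lambda>x. sin (pi * x)) E = (\<lambda>v. 0)"
  proof
    fix v
    have "(\<lambda>k. (sin_coeff k * pi ^ k) *\<^sub>R (E ^^ k) v) sums 0"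
    proof (rule linear_power_series_sums_on_span[OF lin(1), where L = "\<lambda>_. 0", OF _ _ X])
      fix u assume "u \<in> X"
      then obtain j where "j < k" "u \<in> W j" by (auto simp: X_def)
      then have "E u = of_int (- n j) *\<^sub>R u" by (rule E_W)
      moreover have "(\<lambda>k. (sin_coeff k * pi ^ k) * of_int (- n j) ^ k) sums 0"
        using sin_series[of "of_int (- n j)"] unfolding sin_npi_int .
      ultimately have "(\<lambda>k. (sin_coeff k * pi ^ k) *\<^sub>R (E ^^ k) u) sums (0 *\<^sub>R u)"
        by (rule linear_power_series_eigenvalue[OF lin(1)])
      then show "(\<lambda>k. (sin_coeff k * pi ^ k) *\<^sub>R (E ^^ k) u) sums 0" by simp
    qed (rule linear_zero)
    then show "entire_apply (\<lambda>x. sin (pi * x)) E v = 0"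
      using entire_apply_sin_sums[OF fd lin(1)] sums_unique2 by blast
  qed
  have exp_T: "(\<lambda>k. (pi ^ k / fact k) *\<^sub>R (T ^^ k) v) sums \<rho> (- 1) v"
    and exp_minus_T: "(\<lambda>k. ((- pi) ^ k / fact k) *\<^sub>R (T ^^ k) v) sums \<rho> (- 1) v" for v
  proof -
    have "exp (\<i> * of_real (- pi)) = - 1"
      using exp_pi_i' by (simp add: exp_minus)
    then show "(\<lambda>k. (pi ^ k / fact k) *\<^sub>R (T ^^ k) v) sums \<rho> (- 1) v"
      "(\<lambda>k. ((- pi) ^ k / fact k) *\<^sub>R (T ^^ k) v) sums \<rho> (- 1) v"
      using T_series[of pi v] T_series[of "- pi" v] exp_pi_i' by simp_all
  qed
  have sinh_T: "entire_apply (\<lambda>x. sinh (pi * x)) T = (\<lambda>v. 0)"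
  proof
    fix v
    have "(\<lambda>k. (1 / 2) *\<^sub>R ((pi ^ k / fact k) *\<^sub>R (T ^^ k) v - ((- pi) ^ k / fact k) *\<^sub>R (T ^^ k) v))
        sums ((1 / 2) *\<^sub>R (\<rho> (- 1) v - \<rho> (- 1) v))"
      by (intro sums_scaleR_right sums_diff exp_T exp_minus_T)
    also have "(\<lambda>k. (1 / 2) *\<^sub>R ((pi ^ k / fact k) *\<^sub>R (T ^^ k) v - ((- pi) ^ k / fact k) *\<^sub>R (T ^^ k) v))
        = (\<lambda>k. (if even k then 0 else pi ^ k / fact k) *\<^sub>R (T ^^ k) v)"
      by (auto simp flip: scaleR_diff_left)
    finally show "entire_apply (\<lambda>x. sinh (pi * x)) T v = 0"
      using entire_apply_sinh_sums[OF fd lin(2), of pi v] sums_unique2 by fastforce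
  qed
  \<comment> \<open>\<open>cos (\<pi> E)\<close> and \<open>exp (\<pi> T)\<close> are both \<open>\<rho> (- 1)\<close>, which forces \<open>a\<close> and \<open>m\<close> below to have the same parity.\<close>
  have cos_E: "(\<lambda>k. (cos_coeff k * pi ^ k) *\<^sub>R (E ^^ k) v) sums \<rho> (- 1) v" for v
  proof (rule linear_power_series_sums_on_span[OF lin(1) _ _ X])
    show "linear (\<rho> (- 1))" by (simp add: \<rho>_lin)
    fix u assume "u \<in> X"
    then obtain j where j: "j < k" "u \<in> W j" by (auto simp: X_def)
    have "(\<lambda>k. (cos_coeff k * pi ^ k) *\<^sub>R (E ^^ k) u) sums (cos (pi * of_int (- n j)) *\<^sub>R u)"
      by (rule linear_power_series_eigenvalue[OF lin(1) E_W[OF j] cos_series])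
    moreover have "\<rho> (- 1) u = cos (pi * of_int (- n j)) *\<^sub>R u"
      using weight[of "- 1", OF _ j] by (simp add: power_int_minus_left cos_npi_int del: of_int_minus)
    ultimately show "(\<lambda>k. (cos_coeff k * pi ^ k) *\<^sub>R (E ^^ k) u) sums \<rho> (- 1) u" by simp
  qed
  have parity: "v = 0 \<or> even (a - int m)" if vw: "hodge_vector E T a m v w" for a m v w
  proof -
    have "E v = of_int a *\<^sub>R v" using vw by (simp add: hodge_vector_def)
    then have "(\<lambda>k. (cos_coeff k * pi ^ k) *\<^sub>R (E ^^ k) v) sums (cos (pi * of_int a) *\<^sub>R v)"
      by (rule linear_power_series_eigenvalue[OF lin(1) _ cos_series])
    then have 1: "\<rho> (- 1) v = cos (pi * of_int a) *\<^sub>R v" using cos_E sums_unique2 by blast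
    let ?F = "exp (of_real pi * Complex 0 (real m))"
    have "(\<lambda>k. (pi ^ k / fact k) *\<^sub>R Complex 0 (real m) ^ k) sums ?F"
      using exp_converges[of "of_real pi * Complex 0 (real m)"]
      by (simp add: power_mult_distrib scaleR_conv_of_real field_simps)
    then have "(\<lambda>k. (pi ^ k / fact k) *\<^sub>R (T ^^ k) v) sums (Re ?F *\<^sub>R v + Im ?F *\<^sub>R w)"
      using vw by (intro linear_power_series_eigenvector[OF lin(2)]) (auto simp: hodge_vector_def)
    moreover have "?F = cis (pi * real m)" by (simp add: cis_conv_exp Complex_eq mult_ac)
    \<comment> \<open>The coefficient of \<open>w\<close> is \<open>sin (pi * m) = 0\<close>, so
      \<open>exp (pi T)\<close> acts on \<open>v\<close> as a real scalar that can be compared with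
      the one coming from \<open>E\<close>.\<close>
    ultimately have "\<rho> (- 1) v = cos (pi * of_int (int m)) *\<^sub>R v"
      using exp_T[of v] sums_unique2 by (fastforce simp: mult.commute)
    with 1 have "cos (pi * of_int a) = cos (pi * of_int (int m)) \<or> v = 0" by (metis scaleR_cancel_right)
    then show ?thesis unfolding cos_npi_int by (auto split: if_splits)
  qed
  have sin_ET: "entire_apply (\<lambda>x. sin (pi / 2 * x)) (\<lambda>v. (E ^^ 2) v + (T ^^ 2) v) = (\<lambda>v. 0)"
  proof
    fix v
    let ?A = "\<lambda>v. (E ^^ 2) v + (T ^^ 2) v"
    let ?H = "{v. \<exists>n m w. hodge_vector E T n m v w}"
    have A: "linear ?A" using lin by (intro linear_compose_add linear_funpow)
    \<comment> \<open>The first two equations already give spanning Hodge vectors; on each of them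
      \<open>parity\<close> makes the third series vanish.\<close>
    have "v \<in> span ?H" using hodge_vectors_span[OF fd lin comm sin_E sinh_T] by blast
    have "(\<lambda>k. (sin_coeff k * (pi / 2) ^ k) *\<^sub>R (?A ^^ k) v) sums 0"
    proof (rule linear_power_series_sums_on_span[OF A, where L = "\<lambda>_. 0", OF _ _ \<open>v \<in> span ?H\<close>])
      fix u assume "u \<in> ?H"
      then obtain a m w where uw: "hodge_vector E T a m u w" by blast
      have "sin (pi / 2 * of_int (a\<^sup>2 - (int m)\<^sup>2)) *\<^sub>R u = 0"
        using parity[OF uw] sin_half_pi_diff_squares_eq_0_iff unfolding scaleR_eq_0_iff by blast
      then show "(\<lambda>k. (sin_coeff k * (pi / 2) ^ k) *\<^sub>R (?A ^^ k) u) sums 0"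
        using entire_apply_sin_sums[OF fd A, of "pi / 2" u]
        unfolding entire_apply_sin_half_pi_hodge_vector[OF fd lin uw] by (simp only:)
    qed (rule linear_zero)
    then show "entire_apply (\<lambda>x. sin (pi / 2 * x)) ?A v = 0"
      using entire_apply_sin_sums[OF fd A, of "pi / 2" v] sums_unique2 by blast
  qed
  show ?thesis
    unfolding hodge_pair_def using lin sin_E sinh_T sin_ET by (auto simp: commutator_def comm)
qed

theorem theorem2p1:
  assumes "finite_dimensional_space TYPE('v::real_normed_vector)"
  shows "bij_betw hodge_generators
           {\<rho> :: complex \<Rightarrow> 'v \<Rightarrow> 'v. hodge_structure \<rho>}
           {(E, T). hodge_pair E T}"
proof (rule bij_betw_imageI)
  show "inj_on hodge_generators {\<rho> :: complex \<Rightarrow> 'v \<Rightarrow> 'v. hodge_structure \<rho>}"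
    using algebraic_rep_eq_if_generators_eq[OF assms]
    by (auto simp: inj_on_def hodge_structure_def)
  show "hodge_generators ` {\<rho> :: complex \<Rightarrow> 'v \<Rightarrow> 'v. hodge_structure \<rho>} = {(E, T). hodge_pair E T}"
  proof (intro equalityI subsetI)
    fix x assume "x \<in> hodge_generators ` {\<rho> :: complex \<Rightarrow> 'v \<Rightarrow> 'v. hodge_structure \<rho>}"
    then show "x \<in> {(E, T). hodge_pair E T}"
      using hodge_generators_hodge_pair[OF assms] by (cases x) auto
  next
    fix x :: "('v \<Rightarrow> 'v) \<times> ('v \<Rightarrow> 'v)" assume "x \<in> {(E, T). hodge_pair E T}"
    then obtain E T where "x = (E, T)" and pair: "hodge_pair E T" by blast
    then have "x = hodge_generators (hodge_rep E T)"
      using hodge_generators_hodge_rep[OF assms] by simp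
    then show "x \<in> hodge_generators ` {\<rho> :: complex \<Rightarrow> 'v \<Rightarrow> 'v. hodge_structure \<rho>}"
      using hodge_rep_hodge_structure[OF assms pair] by blast
  qed
qed

end
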